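(* Let $P, Q$ be non-zero fixed integers with $\gcd(P,Q)=1$ and discriminant $\Delta = P^2-4Q>0$, and let $(U_n)_{n\ge 0}$ be the Lucas sequence of the first kind defined by $U_0=0$, $U_1=1$, $U_n = PU_{n-1}-QU_{n-2}$ for $n\ge 2$; equivalently $U_n=(\alpha^n-\beta^n)/(\alpha-\beta)$, where $\alpha,\beta$ are the roots of $x^2-Px+Q$ with $|\alpha|>|\beta|$. Let $k\geq2$ be a fixed integer. Assume the $abc$ conjecture for algebraic number fields: for every number field $K$ and every $\varepsilon>0$, $H_K(a,b,c)\ll_{\varepsilon,K}(\mathrm{rad}_K(a,b,c))^{1+\varepsilon}$ for all $a,b,c\in K^*$ with $a+b+c=0$. Then $$ \bigg|\bigg\{\text{primes } p\leq x:\ p \equiv\pm 1 \pmod{k},\ U_{p-\left(\frac{\Delta}{p}\right)}\not\equiv 0 \pmod{p^2}\bigg\}\bigg| \gg_{\alpha, k}\log x, $$ where $\left(\frac{\Delta}{p}\right)$ denotes the Legendre symbol.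
   Context: An odd prime $p$ is a Lucas–Wieferich prime for the pair $(P,Q)$ if $U_{p-\left(\frac{\Delta}{p}\right)}\equiv 0 \pmod{p^2}$, and a Lucas non-Wieferich prime otherwise; so the theorem counts Lucas non-Wieferich primes $p\le x$ with $p\equiv\pm1\pmod k$. For a number field $K$ with set of places $V_K$ and normalized absolute values $\|\cdot\|_\upsilon$ (real embeddings: $|\psi(x)|$; complex embeddings: $|\psi(x)|^2$; finite places: $N(\mathfrak p)^{-\mathrm{ord}_{\mathfrak p}(x)}$), the height is $H_K(a,b,c)=\prod_{\upsilon\in V_K}\max(\|a\|_\upsilon,\|b\|_\upsilon,\|c\|_\upsilon)$ and the radical is $\mathrm{rad}_K(a,b,c)=\prod_{\mathfrak p\in I_K(a,b,c)}N(\mathfrak p)^{\mathrm{ord}_{\mathfrak p}(p)}$, where $p$ is the rational prime below $\mathfrak p$ and $I_K(a,b,c)$ is the set of prime ideals $\mathfrak p$ of $\mathcal O_K$ at which $\|a\|_\upsilon,\|b\|_\upsilon,\|c\|_\upsilon$ are not all equal. The notation $f\gg g$ means $g<cf$ for some positive constant $c$ (here depending on $\alpha$ and $k$). *)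

theory Defs
  imports Complex_Main "HOL-Number_Theory.Number_Theory" "HOL-Algebra.Algebra"
    "HOL-Algebra.Algebraic_Closure_Type"
begin

section \<open>Lucas sequences\<close>

fun lucas_U :: "int \<Rightarrow> int \<Rightarrow> nat \<Rightarrow> int" where
  "lucas_U P Q 0 = 0"
| "lucas_U P Q (Suc 0) = 1"
| "lucas_U P Q (Suc (Suc n)) = P * lucas_U P Q (Suc n) - Q * lucas_U P Q n"

definition lucas_disc :: "int \<Rightarrow> int \<Rightarrow> int" where
  "lucas_disc P Q = P ^ 2 - 4 * Q"

definition lucas_wieferich :: "int \<Rightarrow> int \<Rightarrow> nat \<Rightarrow> bool" where
  "lucas_wieferich P Q p \<longleftrightarrow>
     [lucas_U P Q (nat (int p - Legendre (lucas_disc P Q) (int p))) = 0] (mod (int p) ^ 2)"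


section \<open>Number fields and their places\<close>

text \<open>
  Every number field embeds into the complex numbers, and heights and radicals are invariant
  under isomorphism, so number fields are taken to be subfields of the complex numbers that are
  finite-dimensional over the rationals.
\<close>

abbreviation complex_ring :: "complex ring" where
  "complex_ring \<equiv> ring_of_type_algebra"

definition number_field :: "complex set \<Rightarrow> bool" where
  "number_field K \<longleftrightarrow> subfield K complex_ring \<and> ring.finite_dimension complex_ring \<rat> K"

definition ring_of_integers :: "complex set \<Rightarrow> complex ring" where
  "ring_of_integers K = complex_ring \<lparr> carrier := {x \<in> K. algebraic_int x} \<rparr>"

definition field_embeddings :: "complex set \<Rightarrow> (complex \<Rightarrow> complex) set" where
  "field_embeddings K = ring_hom (complex_ring \<lparr> carrier := K \<rparr>) complex_ring \<inter> extensional K"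

definition nonzero_primes :: "complex set \<Rightarrow> complex set set" where
  "nonzero_primes K = {\<pp>. primeideal \<pp> (ring_of_integers K) \<and> \<pp> \<noteq> {0}}"

definition ideal_norm :: "complex set \<Rightarrow> complex set \<Rightarrow> nat" where
  "ideal_norm K \<pp> = card (carrier (ring_of_integers K Quot \<pp>))"

text \<open>The exponent of a prime ideal in the factorisation of \<open>(x)\<close>: first for a non-zero integer
  \<open>x\<close> of the field, then for a quotient of two such.\<close>

definition ord_integer :: "complex set \<Rightarrow> complex set \<Rightarrow> complex \<Rightarrow> nat" where
  "ord_integer K \<pp> x = Max {n::nat. x \<in> \<pp> [^]\<^bsub>ideals_set (ring_of_integers K)\<^esub> n}"

definition ord_prime :: "complex set \<Rightarrow> complex set \<Rightarrow> complex \<Rightarrow> int" where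
  "ord_prime K \<pp> x = (THE m. \<exists>u \<in> carrier (ring_of_integers K) - {0}.
      \<exists>v \<in> carrier (ring_of_integers K) - {0}.
        x = u / v \<and> m = int (ord_integer K \<pp> u) - int (ord_integer K \<pp> v))"

text \<open>A complex place is a pair of complex-conjugate embeddings; embeddings are extensional
  functions, whence the restriction of the conjugate to the field.\<close>

datatype place =
    Real_Place "complex \<Rightarrow> complex"
  | Complex_Place "(complex \<Rightarrow> complex) set"
  | Finite_Place "complex set"

definition places :: "complex set \<Rightarrow> place set" where
  "places K =
     Real_Place ` {\<psi> \<in> field_embeddings K. \<psi> ` K \<subseteq> \<real>} \<union>
     Complex_Place ` {{\<psi>, restrict (\<lambda>x. cnj (\<psi> x)) K} | \<psi>.
       \<psi> \<in> field_embeddings K \<and> \<not> \<psi> ` K \<subseteq> \<real>} \<union>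
     Finite_Place ` nonzero_primes K"

text \<open>The value at a complex place does not depend on which of the two conjugate embeddings is
  chosen.\<close>

fun place_abs :: "complex set \<Rightarrow> place \<Rightarrow> complex \<Rightarrow> real" where
  "place_abs K (Real_Place \<psi>) x = cmod (\<psi> x)"
| "place_abs K (Complex_Place S) x = (cmod ((SOME \<psi>. \<psi> \<in> S) x)) ^ 2"
| "place_abs K (Finite_Place \<pp>) x =
     (if x = 0 then 0 else real (ideal_norm K \<pp>) powi (- ord_prime K \<pp> x))"


section \<open>The abc conjecture for number fields\<close>

definition place_max :: "complex set \<Rightarrow> place \<Rightarrow> complex \<Rightarrow> complex \<Rightarrow> complex \<Rightarrow> real" where
  "place_max K v a b c = max (place_abs K v a) (max (place_abs K v b) (place_abs K v c))"

text \<open>The product over all places has only finitely many factors different from 1 when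
  \<open>a\<close>, \<open>b\<close>, \<open>c\<close> are non-zero.\<close>

definition abc_height :: "complex set \<Rightarrow> complex \<Rightarrow> complex \<Rightarrow> complex \<Rightarrow> real" where
  "abc_height K a b c = (\<Prod>v \<in> {v \<in> places K. place_max K v a b c \<noteq> 1}. place_max K v a b c)"

definition abc_primes :: "complex set \<Rightarrow> complex \<Rightarrow> complex \<Rightarrow> complex \<Rightarrow> complex set set" where
  "abc_primes K a b c = {\<pp> \<in> nonzero_primes K.
     \<not> (place_abs K (Finite_Place \<pp>) a = place_abs K (Finite_Place \<pp>) b \<and>
        place_abs K (Finite_Place \<pp>) b = place_abs K (Finite_Place \<pp>) c)}"

definition prime_below :: "complex set \<Rightarrow> nat" where
  "prime_below \<pp> = (THE p. Factorial_Ring.prime p \<and> of_nat p \<in> \<pp>)"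

definition abc_radical :: "complex set \<Rightarrow> complex \<Rightarrow> complex \<Rightarrow> complex \<Rightarrow> real" where
  "abc_radical K a b c = (\<Prod>\<pp> \<in> abc_primes K a b c.
     real (ideal_norm K \<pp>) powi ord_prime K \<pp> (of_nat (prime_below \<pp>)))"

definition abc_conjecture_number_fields :: bool where
  "abc_conjecture_number_fields \<longleftrightarrow>
     (\<forall>K. number_field K \<longrightarrow> (\<forall>\<epsilon>>0. \<exists>C>0. \<forall>a \<in> K - {0}. \<forall>b \<in> K - {0}. \<forall>c \<in> K - {0}.
        a + b + c = 0 \<longrightarrow> abc_height K a b c < C * abc_radical K a b c powr (1 + \<epsilon>)))"

end

theory Submission
  imports Defs
begin

text \<open>
  With \<open>V\<^sub>n = 2 U\<^bsub>n+1\<^esub> - P U\<^sub>n\<close> one has \<open>V\<^sub>n\<^sup>2 - \<Delta> U\<^sub>n\<^sup>2 = 4 Q\<^sup>n\<close>, so the \<open>abc\<close> conjecture is only needed over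
  the rationals: it bounds the radical of \<open>U\<^sub>n\<close> from below by almost \<open>\<bar>\<alpha>\<bar>\<^sup>n\<close>. Hence \<open>U\<^sub>n\<close> has a prime divisor \<open>p\<close>
  that divides it exactly once and divides no \<open>U\<^bsub>n/d\<^esub>\<close> for \<open>d\<close> in a prescribed set of divisors of \<open>n\<close> with small sum of
  reciprocals; this takes the place of a lower bound for cyclotomic values.
  For \<open>n = k\<^sup>j m\<close> the set can be chosen such that the rank of apparition \<open>r\<close> of \<open>p\<close> is a multiple of \<open>k\<close>
  exceeding \<open>n/B\<close>, provided that the sum of \<open>1/d\<close> over the divisors \<open>d \<ge> B\<close> of \<open>n\<close> is small, which
  on average it is. Since \<open>r\<close> divides \<open>p - (\<Delta>/p)\<close> with a quotient prime to \<open>p\<close>, the prime \<open>p\<close> is congruent to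
  \<open>\<plusminus>1\<close> modulo \<open>k\<close> and is not Lucas-Wieferich. Each such prime arises from at most \<open>B\<close> values of \<open>m\<close>,
  and \<open>p \<le> \<bar>U\<^sub>n\<bar>\<close> grows only exponentially in \<open>m\<close>.
\<close>

section \<open>Divisibility in Lucas sequences\<close>

text \<open>Both sides satisfy the same recurrence in \<open>a\<close>. Replacing -Q U_{a-1} by
  U_{a+1} - P U_a in the usual formula avoids the index a - 1.\<close>

lemma lucas_U_add:
  "lucas_U P Q (a + b) = lucas_U P Q a * lucas_U P Q (Suc b) + lucas_U P Q b * lucas_U P Q (Suc a)
     - P * lucas_U P Q a * lucas_U P Q b"
proof (induction a rule: induct_nat_012)
  case (ge2 n)
  have "lucas_U P Q (Suc (Suc n) + b) = P * lucas_U P Q (Suc n + b) - Q * lucas_U P Q (n + b)"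
    by simp
  then show ?case
    unfolding ge2 by (simp add: algebra_simps)
qed simp_all

lemma lucas_U_add_Suc:
  "lucas_U P Q (Suc (a + b)) = lucas_U P Q (Suc a) * lucas_U P Q (Suc b) - Q * lucas_U P Q a * lucas_U P Q b"
  using lucas_U_add[of P Q a "Suc b"] by (simp add: algebra_simps)

lemma lucas_U_cong_power: "[lucas_U P Q (Suc n) = P ^ n] (mod Q)"
proof (induction n)
  case (Suc n)
  have "[P * lucas_U P Q (Suc n) - Q * lucas_U P Q n = P * P ^ n - 0] (mod Q)"
    by (intro cong_diff cong_mult Suc.IH) (simp_all add: cong_0_iff)
  then show ?case by simp
qed simp

lemma coprime_lucas_U_Q:
  assumes "coprime P Q"
  shows "coprime (lucas_U P Q (Suc n)) Q"
  using assms lucas_U_cong_power[of P Q n]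
  by (metis cong_imp_coprime cong_sym coprime_power_left_iff)

text \<open>By the recurrence, a common divisor of U_{n+1} and U_{n+2} divides Q U_n, while U_{n+1}
  is prime to both factors.\<close>

lemma coprime_lucas_U_Suc:
  assumes "coprime P Q"
  shows "coprime (lucas_U P Q n) (lucas_U P Q (Suc n))"
proof (induction n)
  case (Suc n)
  have "coprime (lucas_U P Q (Suc n)) (Q * lucas_U P Q n)"
    using Suc coprime_lucas_U_Q[OF assms, of n] by (simp add: coprime_commute)
  moreover have "[Q * lucas_U P Q n = - lucas_U P Q (Suc (Suc n))] (mod lucas_U P Q (Suc n))"
    by (simp add: cong_iff_dvd_diff)
  ultimately have "coprime (lucas_U P Q (Suc n)) (- lucas_U P Q (Suc (Suc n)))"
    using cong_imp_coprime coprime_commute by blast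
  then show ?case unfolding coprime_minus_right_iff .
qed simp

lemma lucas_U_dvd_mult: "lucas_U P Q r dvd lucas_U P Q (r * t)"
proof (induction t)
  case (Suc t)
  then show ?case
    using lucas_U_add[of P Q r "r * t"] by simp
qed simp

lemma lucas_U_dvd:
  assumes "m dvd n"
  shows "lucas_U P Q m dvd lucas_U P Q n"
  using assms lucas_U_dvd_mult by (elim dvdE) simp

section \<open>Lucas numbers modulo the square of U_r\<close>

text \<open>In the formula for U_{r + rt + 1} the term Q U_r U_{rt} vanishes modulo U_r^2, because
  U_r divides U_{rt}.\<close>

lemma lucas_U_Suc_mult_cong:
  "[lucas_U P Q (Suc (r * t)) = lucas_U P Q (Suc r) ^ t] (mod lucas_U P Q r ^ 2)"
proof (induction t)
  case (Suc t)
  have "lucas_U P Q r ^ 2 dvd Q * lucas_U P Q r * lucas_U P Q (r * t)"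
    using lucas_U_dvd_mult[of P Q r t] by (auto simp: power2_eq_square mult.assoc intro!: dvd_mult mult_dvd_mono)
  then have "[lucas_U P Q (Suc r) * lucas_U P Q (Suc (r * t)) - Q * lucas_U P Q r * lucas_U P Q (r * t)
      = lucas_U P Q (Suc r) * lucas_U P Q (Suc r) ^ t - 0] (mod lucas_U P Q r ^ 2)"
    by (intro cong_diff cong_mult Suc.IH) (simp_all add: cong_0_iff)
  then show ?case
    using lucas_U_add_Suc[of P Q r "r * t"] by simp
qed simp

text \<open>First-order lifting: U_{rt} / U_r behaves like t U_{r+1}^(t-1). Writing the multiplier
  as \<open>Suc t\<close> keeps the exponent free of subtraction.\<close>

lemma lucas_U_mult_cong:
  "[lucas_U P Q (r * Suc t) = int (Suc t) * lucas_U P Q r * lucas_U P Q (Suc r) ^ t]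
     (mod lucas_U P Q r ^ 2)"
proof (induction t)
  case (Suc t)
  let ?u = "lucas_U P Q r" and ?v = "lucas_U P Q (Suc r)"
  have "?u ^ 2 dvd P * ?u * lucas_U P Q (r * Suc t)"
    using lucas_U_dvd_mult[of P Q r "Suc t"]
    by (auto simp: power2_eq_square mult.assoc simp del: mult_Suc_right intro!: dvd_mult mult_dvd_mono)
  then have "[?u * lucas_U P Q (Suc (r * Suc t)) + lucas_U P Q (r * Suc t) * ?v - P * ?u * lucas_U P Q (r * Suc t)
     = ?u * ?v ^ Suc t + int (Suc t) * ?u * ?v ^ t * ?v - 0] (mod ?u ^ 2)"
    by (intro cong_diff cong_add cong_mult Suc.IH lucas_U_Suc_mult_cong) (simp_all add: cong_0_iff)
  moreover have "lucas_U P Q (r * Suc (Suc t)) = ?u * lucas_U P Q (Suc (r * Suc t)) + lucas_U P Q (r * Suc t) * ?v - P * ?u * lucas_U P Q (r * Suc t)"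
    using lucas_U_add[of P Q r "r * Suc t"] by (simp add: add.commute)
  moreover have "?u * ?v ^ Suc t + int (Suc t) * ?u * ?v ^ t * ?v - 0 = int (Suc (Suc t)) * ?u * ?v ^ Suc t"
    by (simp add: algebra_simps)
  ultimately show ?case
    by metis
qed simp

text \<open>The congruence modulo U_r^2 also holds modulo p^2, where the factor t U_{r+1}^(t-1) is
  invertible, so U_{rt} and U_r contain \<open>p\<close> equally far.\<close>

lemma prime_square_not_dvd_lucas_U_mult:
  fixes p :: int
  assumes "coprime P Q" "Factorial_Ring.prime p" "p dvd lucas_U P Q r" "\<not> p ^ 2 dvd lucas_U P Q r"
    and "\<not> p dvd int t"
  shows "\<not> p ^ 2 dvd lucas_U P Q (r * t)"
proof
  assume *: "p ^ 2 dvd lucas_U P Q (r * t)"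
  obtain s where t: "t = Suc s" using assms(5) by (cases t) auto
  have "p ^ 2 dvd lucas_U P Q r ^ 2" using assms(3) by simp
  from cong_dvd_modulus[OF lucas_U_mult_cong this]
  have "p ^ 2 dvd int t * lucas_U P Q r * lucas_U P Q (Suc r) ^ s"
    using * t cong_dvd_iff by metis
  moreover have "coprime p (lucas_U P Q (Suc r))"
    using coprime_lucas_U_Suc[OF assms(1), of r] assms(3) coprime_divisors[OF assms(3) dvd_refl] by blast
  moreover have "coprime p (int t)"
    using assms(2,5) prime_imp_coprime by blast
  ultimately have "p ^ 2 dvd lucas_U P Q r"
    by (simp add: coprime_dvd_mult_left_iff coprime_dvd_mult_right_iff)
  with assms(4) show False ..
qed

section \<open>Rank of apparition\<close>

text \<open>The rank is the least positive index. If q is the largest multiple of \<open>r\<close>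
  up to m, then U_m is U_{m mod r} U_{q+1} modulo \<open>p\<close>, and U_{q+1} is prime to
  \<open>p\<close>; minimality forces m mod r = 0.\<close>

lemma lucas_U_rank:
  fixes p :: int
  assumes "coprime P Q" "Factorial_Ring.prime p" "0 < n" "p dvd lucas_U P Q n"
  obtains r where "0 < r" "\<And>m. p dvd lucas_U P Q m \<longleftrightarrow> r dvd m"
proof -
  define r where "r = (LEAST r. 0 < r \<and> p dvd lucas_U P Q r)"
  have r: "0 < r \<and> p dvd lucas_U P Q r"
    unfolding r_def by (rule LeastI[of _ n]) (use assms in auto)
  have least: "\<not> p dvd lucas_U P Q m" if "0 < m" "m < r" for m
    using not_less_Least[of m "\<lambda>r. 0 < r \<and> p dvd lucas_U P Q r"] that unfolding r_def by blast
  have "r dvd m" if m: "p dvd lucas_U P Q m" for m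
  proof -
    let ?q = "r * (m div r)"
    have q: "p dvd lucas_U P Q ?q"
      using r lucas_U_dvd_mult dvd_trans by blast
    have cop: "coprime p (lucas_U P Q (Suc ?q))"
      using coprime_lucas_U_Suc[OF assms(1), of ?q] coprime_divisors[OF q dvd_refl] by blast
    have "lucas_U P Q m = lucas_U P Q ?q * lucas_U P Q (Suc (m mod r))
       + lucas_U P Q (m mod r) * lucas_U P Q (Suc ?q) - P * lucas_U P Q ?q * lucas_U P Q (m mod r)"
      using lucas_U_add[of P Q ?q "m mod r"] by simp
    then have "lucas_U P Q (m mod r) * lucas_U P Q (Suc ?q) = lucas_U P Q m
       - lucas_U P Q ?q * (lucas_U P Q (Suc (m mod r)) - P * lucas_U P Q (m mod r))"
      by (simp add: algebra_simps)
    then have "p dvd lucas_U P Q (m mod r) * lucas_U P Q (Suc ?q)"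
      using m q by (metis dvd_diff dvd_mult2)
    then have "p dvd lucas_U P Q (m mod r)"
      using cop coprime_dvd_mult_left_iff by blast
    then have "m mod r = 0"
      using least[of "m mod r"] r by (metis gr0I mod_less_divisor)
    then show ?thesis by auto
  qed
  moreover have "p dvd lucas_U P Q m" if "r dvd m" for m
    using r that lucas_U_dvd dvd_trans by blast
  ultimately show ?thesis using r that by blast
qed

section \<open>The law of apparition\<close>

text \<open>The image of the polynomial (P + X)^n under the linear functional X^i \<mapsto>
  \<open>w i\<close>. It allows computing with (P + \<surd>\<Delta>)^n inside the integers.\<close>

definition binomial_functional :: "int \<Rightarrow> nat \<Rightarrow> (nat \<Rightarrow> int) \<Rightarrow> int" where
  "binomial_functional P n w = (\<Sum>i\<le>n. int (n choose i) * P ^ (n - i) * w i)"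

text \<open>Multiplication by P + X: the factor X shifts the weights.\<close>

lemma binomial_functional_Suc:
  "binomial_functional P (Suc n) w = P * binomial_functional P n w + binomial_functional P n (w \<circ> Suc)"
proof -
  have "P * binomial_functional P n w = (\<Sum>i\<le>n. int (n choose i) * P ^ (Suc n - i) * w i)"
    unfolding binomial_functional_def sum_distrib_left
    by (intro sum.cong refl) (simp add: Suc_diff_le mult_ac)
  also have "\<dots> = (\<Sum>i\<le>Suc n. int (n choose i) * P ^ (Suc n - i) * w i)"
    by simp
  also have "\<dots> = P ^ Suc n * w 0 + (\<Sum>i\<le>n. int (n choose Suc i) * P ^ (n - i) * w (Suc i))"
    unfolding sum.atMost_Suc_shift by simp
  finally have *: "P * binomial_functional P n w = \<dots>" .
  have "binomial_functional P (Suc n) w =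
      P ^ Suc n * w 0 + (\<Sum>i\<le>n. int (Suc n choose Suc i) * P ^ (n - i) * w (Suc i))"
    unfolding binomial_functional_def sum.atMost_Suc_shift by simp
  also have "(\<Sum>i\<le>n. int (Suc n choose Suc i) * P ^ (n - i) * w (Suc i)) =
      (\<Sum>i\<le>n. int (n choose Suc i) * P ^ (n - i) * w (Suc i)) + binomial_functional P n (w \<circ> Suc)"
    unfolding binomial_functional_def sum.distrib[symmetric]
    by (intro sum.cong refl) (simp add: distrib_right)
  finally show ?thesis using * by simp
qed

text \<open>The functional form of (P + X)^p = P^p + X^p modulo \<open>p\<close>; all inner binomial
  coefficients vanish.\<close>

lemma binomial_functional_prime_cong:
  assumes "Factorial_Ring.prime p"
  shows "[binomial_functional P p w = P ^ p * w 0 + w p] (mod int p)"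
proof -
  have p: "0 < p" using assms prime_gt_0_nat by blast
  have "{..p} = insert 0 (insert p {0<..<p})" using p by auto
  then have "binomial_functional P p w = P ^ p * w 0 + (w p + (\<Sum>i\<in>{0<..<p}. int (p choose i) * P ^ (p - i) * w i))"
    using p by (simp add: binomial_functional_def)
  moreover have "int p dvd (\<Sum>i\<in>{0<..<p}. int (p choose i) * P ^ (p - i) * w i)"
    using assms by (intro dvd_sum dvd_mult2) (auto intro: dvd_choose_prime)
  ultimately show ?thesis
    by (simp add: cong_iff_dvd_diff)
qed

text \<open>The two functionals collect the rational part and the coefficient of \<open>\<surd>\<Delta>\<close> in the expansion of
  \<open>(P + \<surd>\<Delta>)\<^sup>n\<close>.\<close>

lemma lucas_U_binomial:
  fixes P Q
  defines "D \<equiv> lucas_disc P Q"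
  shows "2 ^ n * lucas_U P Q n = 2 * binomial_functional P n (\<lambda>i. if odd i then D ^ (i div 2) else 0)"
    and "2 ^ n * (2 * lucas_U P Q (Suc n) - P * lucas_U P Q n) =
      2 * binomial_functional P n (\<lambda>i. if even i then D ^ (i div 2) else 0)"
proof (induction n)
  case 0
  {
    case 1
    show ?case by (simp add: binomial_functional_def)
  next
    case 2
    show ?case by (simp add: binomial_functional_def)
  }
next
  case (Suc n)
  let ?o = "\<lambda>i. if odd i then D ^ (i div 2) else 0" and ?e = "\<lambda>i. if even i then D ^ (i div 2) else 0"
  \<comment> \<open>The shift is multiplication by \<surd>D: it exchanges the two weights, in one
    direction with a factor D.\<close>
  have o: "?o \<circ> Suc = ?e" by (auto simp: fun_eq_iff)
  have e: "?e \<circ> Suc = (\<lambda>i. D * ?o i)" by (auto simp: fun_eq_iff elim!: oddE)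
  have D: "binomial_functional P n (\<lambda>i. D * ?o i) = D * binomial_functional P n ?o"
    by (simp add: binomial_functional_def sum_distrib_left algebra_simps)
  {
    case 1
    show ?case
      unfolding binomial_functional_Suc o using Suc by (simp add: algebra_simps)
  next
    case 2
    have "2 ^ Suc n * (2 * lucas_U P Q (Suc (Suc n)) - P * lucas_U P Q (Suc n)) =
       P * (2 ^ n * (2 * lucas_U P Q (Suc n) - P * lucas_U P Q n)) + D * (2 ^ n * lucas_U P Q n)"
      by (simp add: D_def lucas_disc_def algebra_simps power2_eq_square)
    also have "\<dots> = 2 * binomial_functional P (Suc n) ?e"
      unfolding binomial_functional_Suc e D Suc by (simp add: algebra_simps)
    finally show ?case .
  }
qed

lemma fermat_little_int:
  assumes "Factorial_Ring.prime p"
  shows "[a ^ p = a] (mod int p)"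
proof (cases "int p dvd a")
  case True
  then show ?thesis
    using assms by (meson cong_0_iff cong_sym cong_trans dvd_power dvd_trans prime_gt_0_nat)
next
  case False
  have "a ^ p = a * a ^ (p - 1)"
    using prime_gt_0_nat[OF assms] by (cases p) auto
  moreover have "[a ^ (p - 1) = 1] (mod int p)"
  proof -
    define n where "n = nat (a mod int p)"
    have n: "int n = a mod int p"
      using prime_gt_0_nat[OF assms] by (simp add: n_def)
    have "\<not> p dvd n"
      using False by (metis n dvd_mod_iff dvd_refl int_dvd_int_iff)
    then have "[n ^ (p - 1) = 1] (mod p)"
      using fermat_theorem[OF assms] by blast
    then have "[int n ^ (p - 1) = 1] (mod int p)"
      by (metis cong_int_iff of_nat_1 of_nat_power)
    moreover have "[a ^ (p - 1) = int n ^ (p - 1)] (mod int p)"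
      unfolding n by (intro cong_pow) (simp add: cong_def)
    ultimately show ?thesis using cong_trans by blast
  qed
  then have "[a * a ^ (p - 1) = a * 1] (mod int p)"
    by (intro cong_mult cong_refl)
  ultimately show ?thesis by simp
qed

text \<open>With L the Legendre symbol, the binomial expansions modulo \<open>p\<close> and Euler's
  criterion give U_p = L and V_p = P, where V_p = 2 U_{p+1} - P U_p. The claim follows from 2 Q
  U_{p-1} = P U_p - V_p if L = 1 and from 2 U_{p+1} = P U_p + V_p if L = -1.\<close>

lemma lucas_apparition:
  assumes p: "Factorial_Ring.prime p" "odd p" and "\<not> int p dvd Q" "\<not> int p dvd lucas_disc P Q"
  shows "int p dvd lucas_U P Q (nat (int p - Legendre (lucas_disc P Q) (int p)))"
proof -
  let ?U = "lucas_U P Q" and ?D = "lucas_disc P Q"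
  define L where "L = Legendre ?D (int p)"
  have p2: "2 < int p" using p prime_ge_2_nat[OF p(1)] by (cases "p = 2") auto
  have cop2: "coprime 2 (int p)" using p(2) by simp
  have "[2 ^ p * ?U p = 2 * ?D ^ (p div 2)] (mod int p)"
    unfolding lucas_U_binomial using binomial_functional_prime_cong[OF p(1), of P "\<lambda>i. if odd i then ?D ^ (i div 2) else 0"] p(2)
    by (intro cong_mult) auto
  moreover have "[2 ^ p * ?U p = 2 * ?U p] (mod int p)"
    by (intro cong_mult fermat_little_int p) auto
  ultimately have "[2 * ?U p = 2 * ?D ^ (p div 2)] (mod int p)"
    using cong_sym cong_trans by blast
  then have "[?U p = ?D ^ (p div 2)] (mod int p)"
    using cong_mult_lcancel cop2 by blast
  moreover have "[L = ?D ^ (p div 2)] (mod int p)"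
    using euler_criterion[of p ?D] p p2 unfolding L_def by (auto elim!: oddE)
  ultimately have U: "[?U p = L] (mod int p)"
    using cong_sym cong_trans by blast
  have "[2 ^ p * (2 * ?U (Suc p) - P * ?U p) = 2 * P ^ p] (mod int p)"
    unfolding lucas_U_binomial using binomial_functional_prime_cong[OF p(1), of P "\<lambda>i. if even i then ?D ^ (i div 2) else 0"] p(2)
    by (intro cong_mult) auto
  moreover have "[2 ^ p * (2 * ?U (Suc p) - P * ?U p) = 2 * (2 * ?U (Suc p) - P * ?U p)] (mod int p)"
    by (intro cong_mult fermat_little_int p) auto
  moreover have "[2 * P ^ p = 2 * P] (mod int p)"
    by (intro cong_mult fermat_little_int p) auto
  ultimately have "[2 * (2 * ?U (Suc p) - P * ?U p) = 2 * P] (mod int p)"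
    using cong_sym cong_trans by blast
  then have V: "[2 * ?U (Suc p) - P * ?U p = P] (mod int p)"
    using cong_mult_lcancel cop2 by blast
  have "\<not> [?D = 0] (mod int p)" using assms(4) by (simp add: cong_0_iff)
  then consider "L = 1" | "L = -1" unfolding L_def Legendre_def by presburger
  then show ?thesis
  proof cases
    case 1
    obtain q where q: "p = Suc q" using prime_gt_0_nat[OF p(1)] by (cases p) auto
    have dU: "int p dvd ?U p - 1" using U 1 by (simp add: cong_iff_dvd_diff)
    have dV: "int p dvd 2 * ?U (Suc p) - P * ?U p - P" using V by (simp add: cong_iff_dvd_diff)
    have "2 * Q * ?U q = P * (?U p - 1) - (2 * ?U (Suc p) - P * ?U p - P)"
      unfolding q by (simp add: algebra_simps)
    then have "int p dvd 2 * Q * ?U q"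
      using dU dV by (metis dvd_diff dvd_mult)
    moreover have "coprime (int p) Q"
      using assms(1,3) by (intro prime_imp_coprime) auto
    then have "coprime (int p) (2 * Q)"
      using cop2 by (simp add: coprime_commute)
    ultimately have "int p dvd ?U q"
      using coprime_dvd_mult_right_iff by blast
    then show ?thesis using 1 q by (simp add: L_def)
  next
    case 2
    have dU: "int p dvd ?U p + 1" using U 2 by (simp add: cong_iff_dvd_diff)
    have dV: "int p dvd 2 * ?U (Suc p) - P * ?U p - P" using V by (simp add: cong_iff_dvd_diff)
    have "2 * ?U (Suc p) = P * (?U p + 1) + (2 * ?U (Suc p) - P * ?U p - P)"
      by (simp add: algebra_simps)
    then have "int p dvd 2 * ?U (Suc p)"
      using dU dV by (metis dvd_add dvd_mult)
    then have "int p dvd ?U (Suc p)"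
      using cop2 coprime_commute coprime_dvd_mult_right_iff by blast
    moreover have "nat (int p - L) = Suc p" using 2 by simp
    ultimately show ?thesis by (simp add: L_def)
  qed
qed

section \<open>The \<open>abc\<close> conjecture over the rationals\<close>

text \<open>At \<open>n = 0\<close> the set is infinite and the product takes the default value
  1.\<close>

definition int_radical :: "int \<Rightarrow> nat" where
  "int_radical n = \<Prod>{p. Factorial_Ring.prime p \<and> int p dvd n}"

lemma finite_prime_divisors:
  assumes "n \<noteq> 0"
  shows "finite {p. Factorial_Ring.prime p \<and> int p dvd n}"
proof (rule finite_subset)
  show "{p. Factorial_Ring.prime p \<and> int p dvd n} \<subseteq> {..nat \<bar>n\<bar>}"
  proof (intro subsetI)
    fix p assume "p \<in> {p. Factorial_Ring.prime p \<and> int p dvd n}"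
    then show "p \<in> {..nat \<bar>n\<bar>}"
      using dvd_imp_le_int[OF assms, of "int p"] by simp
  qed
qed simp

section \<open>Prime ideals and places of the rational field\<close>

lemma complex_ring_simps [simp]:
  "carrier complex_ring = UNIV"
  "x \<otimes>\<^bsub>complex_ring\<^esub> y = x * y"
  "x \<oplus>\<^bsub>complex_ring\<^esub> y = x + y"
  "\<one>\<^bsub>complex_ring\<^esub> = 1"
  "\<zero>\<^bsub>complex_ring\<^esub> = 0"
  by (simp_all add: ring_of_type_algebra_def)

lemma number_field_Rats: "number_field \<rat>"
proof -
  interpret C: Ring.field complex_ring
    by (rule field_from_type_algebra)
  have inv: "inv\<^bsub>complex_ring\<^esub> x = inverse x" if "x \<noteq> 0" for x :: complex
    using that by (intro C.comm_inv_char) auto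
  have minus: "\<ominus>\<^bsub>complex_ring\<^esub> x = - x" for x :: complex
    by (intro C.minus_equality) auto
  have sub: "subfield \<rat> complex_ring"
    by (intro C.subfieldI' C.subringI) (auto simp: inv minus)
  show ?thesis
    unfolding number_field_def
    using sub C.finite_dimensionI C.dimension_one[OF sub] by blast
qed

lemma ring_of_integers_simps [simp]:
  "x \<otimes>\<^bsub>ring_of_integers K\<^esub> y = x * y"
  "x \<oplus>\<^bsub>ring_of_integers K\<^esub> y = x + y"
  "\<one>\<^bsub>ring_of_integers K\<^esub> = 1"
  "\<zero>\<^bsub>ring_of_integers K\<^esub> = 0"
  by (simp_all add: ring_of_integers_def ring_of_type_algebra_def)

lemma carrier_ring_of_integers_Rats [simp]: "carrier (ring_of_integers \<rat>) = \<int>"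
proof -
  have "{x \<in> \<rat>. algebraic_int x} = (\<int> :: complex set)"
    using rational_algebraic_int_is_int Ints_subset_Rats by (auto intro: int_imp_algebraic_int)
  then show ?thesis by (simp add: ring_of_integers_def)
qed

definition int_multiples :: "int \<Rightarrow> complex set" where
  "int_multiples d = of_int ` {z. d dvd z}"

lemma of_int_in_int_multiples_iff [simp]: "of_int z \<in> int_multiples d \<longleftrightarrow> d dvd z"
  by (auto simp: int_multiples_def)

lemma of_nat_in_int_multiples_iff [simp]: "of_nat n \<in> int_multiples d \<longleftrightarrow> d dvd int n"
  using of_int_in_int_multiples_iff[of "int n" d] by simp

text \<open>Pulled back to the integers, the ideal is generated by its least positive element, and
  primality of the ideal passes to that generator.\<close>

lemma nonzero_primes_Rats:
  assumes "\<pp> \<in> nonzero_primes \<rat>"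
  obtains p where "Factorial_Ring.prime p" "\<pp> = int_multiples (int p)"
proof -
  interpret I: primeideal \<pp> "ring_of_integers \<rat>"
    using assms by (simp add: nonzero_primes_def)
  define J where "J = {z::int. of_int z \<in> \<pp>}"
  have sub: "\<pp> \<subseteq> \<int>" using I.a_subset by simp
  have pp: "\<pp> = of_int ` J"
    using sub by (auto simp: J_def elim!: Ints_cases)
  have add: "x + y \<in> J" if "x \<in> J" "y \<in> J" for x y
    using additive_subgroup.a_closed[OF I.additive_subgroup_axioms, of "of_int x" "of_int y"] that by (simp add: J_def)
  have mult: "x * y \<in> J" if "y \<in> J" for x y
    using I.I_l_closed[of "of_int y" "of_int x"] that by (simp add: J_def)
  obtain z where z: "z \<in> J" "z \<noteq> 0"
  proof -
    have "0 \<in> \<pp>"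
      using additive_subgroup.zero_closed[OF I.additive_subgroup_axioms] by simp
    moreover have "\<pp> \<noteq> {0}" using assms by (simp add: nonzero_primes_def)
    ultimately obtain w where "w \<in> \<pp>" "w \<noteq> 0" by blast
    then show ?thesis using that pp by auto
  qed
  have "\<bar>z\<bar> \<in> J"
    using mult[OF z(1), of "sgn z"] by (simp add: abs_sgn mult.commute)
  then have z': "int (nat \<bar>z\<bar>) \<in> J" by simp
  define d where "d = (LEAST d. 0 < d \<and> int d \<in> J)"
  have d: "0 < d \<and> int d \<in> J"
    unfolding d_def by (rule LeastI[of _ "nat \<bar>z\<bar>"]) (use z z' in auto)
  have least: "\<not> int m \<in> J" if "0 < m" "m < d" for m
    using not_less_Least[of m "\<lambda>d. 0 < d \<and> int d \<in> J"] that unfolding d_def by blast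
  have dvd: "x \<in> J \<longleftrightarrow> int d dvd x" for x
  proof
    assume x: "x \<in> J"
    have "x + (- (x div int d)) * int d \<in> J"
      using x d by (intro add mult) auto
    then have "x mod int d \<in> J" by (simp add: minus_div_mult_eq_mod)
    then have "int (nat (x mod int d)) \<in> J" using d by simp
    moreover have "nat (x mod int d) < d" using d by (simp add: nat_less_iff)
    ultimately have "\<not> 0 < nat (x mod int d)" using least by blast
    moreover have "0 \<le> x mod int d" using d by simp
    ultimately have "x mod int d = 0" by linarith
    then show "int d dvd x" by auto
  next
    assume "int d dvd x"
    then show "x \<in> J" using mult d by (metis dvd_def mult.commute)
  qed
  have "\<not> int d dvd 1"
  proof
    assume "int d dvd 1"
    then have "J = UNIV" using dvd dvd_trans[OF _ one_dvd] by blast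
    then have "\<pp> = \<int>" unfolding pp Ints_def by simp
    then show False using I.I_notcarr by simp
  qed
  moreover have "int d dvd x \<or> int d dvd y" if "int d dvd x * y" for x y
    using I.I_prime[of "of_int x" "of_int y"] that unfolding dvd[symmetric] by (simp add: J_def)
  ultimately have "Factorial_Ring.prime (int d)"
    using d by (intro prime_intI) (cases "d = 1"; auto)+
  then have "Factorial_Ring.prime d" using prime_nat_int_transfer by blast
  moreover have "\<pp> = int_multiples (int d)"
    unfolding pp int_multiples_def using dvd by auto
  ultimately show ?thesis using that by blast
qed

lemma int_multiples_power:
  "int_multiples d [^]\<^bsub>ideals_set (ring_of_integers \<rat>)\<^esub> (n::nat) = int_multiples (d ^ n)"
proof (induction n)
  case 0
  \<comment> \<open>The zeroth power is the unit of the monoid of ideals, that is, the whole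
    ring.\<close>
  show ?case
    by (auto simp: nat_pow_def ideals_set_def int_multiples_def Ints_def)
next
  case (Suc n)
  have "int_multiples d [^]\<^bsub>ideals_set (ring_of_integers \<rat>)\<^esub> Suc n =
      ideal_prod (ring_of_integers \<rat>) (int_multiples (d ^ n)) (int_multiples d)"
    using Suc by (simp add: nat_pow_def ideals_set_def)
  also have "\<dots> = int_multiples (d ^ Suc n)"
  proof
    show "ideal_prod (ring_of_integers \<rat>) (int_multiples (d ^ n)) (int_multiples d) \<subseteq> int_multiples (d ^ Suc n)"
    proof
      fix x assume "x \<in> ideal_prod (ring_of_integers \<rat>) (int_multiples (d ^ n)) (int_multiples d)"
      then show "x \<in> int_multiples (d ^ Suc n)"
      proof induction
        case (prod i j)
        then obtain a b where "i = of_int a" "d ^ n dvd a" "j = of_int b" "d dvd b"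
          by (auto simp: int_multiples_def)
        moreover from this have "d ^ Suc n dvd a * b"
          unfolding power_Suc2 by (intro mult_dvd_mono)
        ultimately show ?case
          using of_int_in_int_multiples_iff[of "a * b" "d ^ Suc n"] by simp
      next
        case (sum s1 s2)
        then obtain a b where "s1 = of_int a" "d ^ Suc n dvd a" "s2 = of_int b" "d ^ Suc n dvd b"
          by (auto simp: int_multiples_def)
        then show ?case
          using of_int_in_int_multiples_iff[of "a + b" "d ^ Suc n"] by (simp add: dvd_add)
      qed
    qed
  next
    show "int_multiples (d ^ Suc n) \<subseteq> ideal_prod (ring_of_integers \<rat>) (int_multiples (d ^ n)) (int_multiples d)"
    proof
      fix x assume "x \<in> int_multiples (d ^ Suc n)"
      then obtain y where y: "x = of_int y" "d ^ Suc n dvd y"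
        by (auto simp: int_multiples_def)
      then obtain z where "y = d ^ Suc n * z" by (elim dvdE)
      then have x: "x = of_int (d ^ n * z) * of_int d"
        using y by simp
      have "of_int (d ^ n * z) \<otimes>\<^bsub>ring_of_integers \<rat>\<^esub> of_int d \<in>
          ideal_prod (ring_of_integers \<rat>) (int_multiples (d ^ n)) (int_multiples d)"
        by (intro ideal_prod.prod; subst of_int_in_int_multiples_iff) simp_all
      then show "x \<in> ideal_prod (ring_of_integers \<rat>) (int_multiples (d ^ n)) (int_multiples d)"
        by (simp add: x)
    qed
  qed
  finally show ?case .
qed

lemma ord_integer_int_multiples:
  assumes "Factorial_Ring.prime p" "x \<noteq> 0"
  shows "ord_integer \<rat> (int_multiples (int p)) (of_int x) = multiplicity (int p) x"
proof -
  have "\<not> is_unit (int p)"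
    using assms(1) not_prime_unit prime_nat_int_transfer by blast
  then have "{n. int p ^ n dvd x} = {..multiplicity (int p) x}"
    using assms(2) by (auto simp: power_dvd_iff_le_multiplicity)
  then show ?thesis
    by (simp add: ord_integer_def int_multiples_power Max_eq_iff)
qed

text \<open>The fraction x / 1 realises the value; additivity of the multiplicity makes every other
  fraction give the same one, so the definite description is legitimate.\<close>

lemma ord_prime_int_multiples:
  assumes "Factorial_Ring.prime p" "x \<noteq> 0"
  shows "ord_prime \<rat> (int_multiples (int p)) (of_int x) = int (multiplicity (int p) x)"
  unfolding ord_prime_def
proof (rule the_equality)
  show "\<exists>u\<in>carrier (ring_of_integers \<rat>) - {0}. \<exists>v\<in>carrier (ring_of_integers \<rat>) - {0}.
      complex_of_int x = u / v \<and> int (multiplicity (int p) x) =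
      int (ord_integer \<rat> (int_multiples (int p)) u) - int (ord_integer \<rat> (int_multiples (int p)) v)"
    using assms ord_integer_int_multiples[OF assms] ord_integer_int_multiples[OF assms(1), of 1]
    by (intro bexI[of _ "of_int x"] bexI[of _ 1]) auto
next
  fix m
  assume "\<exists>u\<in>carrier (ring_of_integers \<rat>) - {0}. \<exists>v\<in>carrier (ring_of_integers \<rat>) - {0}.
      complex_of_int x = u / v \<and> m =
      int (ord_integer \<rat> (int_multiples (int p)) u) - int (ord_integer \<rat> (int_multiples (int p)) v)"
  then obtain u' v' where uv': "u' \<in> \<int>" "v' \<in> \<int>" "u' \<noteq> 0" "v' \<noteq> 0" "complex_of_int x = u' / v'"
    "m = int (ord_integer \<rat> (int_multiples (int p)) u') - int (ord_integer \<rat> (int_multiples (int p)) v')"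
    by auto
  then obtain u v :: int where "u' = of_int u" "v' = of_int v"
    using Ints_cases by metis
  with uv' have uv: "u \<noteq> 0" "v \<noteq> 0" "complex_of_int x = of_int u / of_int v"
    "m = int (ord_integer \<rat> (int_multiples (int p)) (of_int u)) - int (ord_integer \<rat> (int_multiples (int p)) (of_int v))"
    by auto
  have "complex_of_int (x * v) = of_int u"
    using uv by (simp add: field_simps)
  then have "u = x * v" by (metis of_int_eq_iff)
  then have "multiplicity (int p) u = multiplicity (int p) x + multiplicity (int p) v"
    using assms uv by (simp add: prime_elem_multiplicity_mult_distrib)
  then show "m = int (multiplicity (int p) x)"
    using uv assms by (simp add: ord_integer_int_multiples)
qed

text \<open>Two bounds suffice: positivity makes the absolute values of integers at most 1, and the
  upper bound, from the coset representatives 0, ..., p - 1, controls the radical.\<close>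

lemma ideal_norm_int_multiples:
  assumes "p > 0"
  shows "0 < ideal_norm \<rat> (int_multiples (int p))" "ideal_norm \<rat> (int_multiples (int p)) \<le> p"
proof -
  define coset where "coset = (\<lambda>x. a_r_coset (ring_of_integers \<rat>) (int_multiples (int p)) (of_int x))"
  have coset: "coset x = of_int ` (\<lambda>z. z + x) ` {z. int p dvd z}" for x
    by (auto simp: coset_def a_r_coset_def' int_multiples_def image_image)
  have mod: "coset x = coset (x mod int p)" for x
  proof -
    have eq: "(\<lambda>z. z + x) ` {z. int p dvd z} = (\<lambda>z. z + x mod int p) ` {z. int p dvd z}" (is "?A = ?B")
    proof
      show "?A \<subseteq> ?B"
      proof
        fix y assume "y \<in> ?A"
        then obtain z where "y = z + x" "int p dvd z" by blast
        then show "y \<in> ?B"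
          by (intro image_eqI[of _ _ "z + (x - x mod int p)"]) (auto intro: dvd_add dvd_minus_mod)
      qed
      show "?B \<subseteq> ?A"
      proof
        fix y assume "y \<in> ?B"
        then obtain z where "y = z + x mod int p" "int p dvd z" by blast
        then show "y \<in> ?A"
          by (intro image_eqI[of _ _ "z - (x - x mod int p)"]) (auto intro: dvd_diff dvd_minus_mod)
      qed
    qed
    show ?thesis unfolding coset eq ..
  qed
  have "carrier (ring_of_integers \<rat> Quot int_multiples (int p)) = range coset"
    by (auto simp: FactRing_def A_RCOSETS_def' coset_def Ints_def)
  also have "\<dots> = coset ` {0..<int p}"
  proof
    show "range coset \<subseteq> coset ` {0..<int p}"
    proof
      fix c assume "c \<in> range coset"
      then obtain x where "c = coset x" by blast
      then show "c \<in> coset ` {0..<int p}"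
        using mod[of x] assms by (intro image_eqI[of _ _ "x mod int p"]) auto
    qed
  qed blast
  finally have N: "ideal_norm \<rat> (int_multiples (int p)) = card (coset ` {0..<int p})"
    by (simp add: ideal_norm_def)
  show "0 < ideal_norm \<rat> (int_multiples (int p))"
    unfolding N using assms by (subst card_gt_0_iff) auto
  show "ideal_norm \<rat> (int_multiples (int p)) \<le> p"
    unfolding N using card_image_le[of "{0..<int p}" coset] by simp
qed

lemma prime_below_int_multiples:
  assumes "Factorial_Ring.prime p"
  shows "prime_below (int_multiples (int p)) = p"
  unfolding prime_below_def
  by (rule the_equality) (use assms primes_dvd_imp_eq in auto)

lemma place_abs_int_multiples:
  assumes "Factorial_Ring.prime p" "x \<noteq> 0"
  shows "place_abs \<rat> (Finite_Place (int_multiples (int p))) (of_int x) \<le> 1"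
    and "\<not> int p dvd x \<Longrightarrow> place_abs \<rat> (Finite_Place (int_multiples (int p))) (of_int x) = 1"
proof -
  have "1 \<le> real (ideal_norm \<rat> (int_multiples (int p))) ^ n" for n
    using ideal_norm_int_multiples(1)[of p] assms(1) prime_gt_0_nat[of p] by (intro one_le_power) simp
  then show "place_abs \<rat> (Finite_Place (int_multiples (int p))) (of_int x) \<le> 1"
    using assms by (simp add: ord_prime_int_multiples power_int_minus inverse_le_1_iff)
  show "place_abs \<rat> (Finite_Place (int_multiples (int p))) (of_int x) = 1" if "\<not> int p dvd x"
    using assms that by (simp add: ord_prime_int_multiples not_dvd_imp_multiplicity_0)
qed

text \<open>A homomorphism fixes 1, hence all integers and their quotients; extensionality
  determines it outside the field.\<close>

lemma field_embeddings_Rats: "field_embeddings \<rat> = {restrict id \<rat>}"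
proof (intro equalityI subsetI)
  fix \<psi> assume "\<psi> \<in> field_embeddings \<rat>"
  then have hom: "\<psi> \<in> ring_hom (complex_ring \<lparr> carrier := \<rat> \<rparr>) complex_ring" and ext: "\<psi> \<in> extensional \<rat>"
    by (auto simp: field_embeddings_def)
  have one: "\<psi> 1 = 1" using ring_hom_one[OF hom] by simp
  have add: "\<psi> (x + y) = \<psi> x + \<psi> y" if "x \<in> \<rat>" "y \<in> \<rat>" for x y
    using ring_hom_add[OF hom] that by simp
  have mult: "\<psi> (x * y) = \<psi> x * \<psi> y" if "x \<in> \<rat>" "y \<in> \<rat>" for x y
    using ring_hom_mult[OF hom] that by simp
  have zero: "\<psi> 0 = 0" using add[of 0 0] by simp
  have nat: "\<psi> (of_nat n) = of_nat n" for n
    by (induction n) (simp_all add: zero one add)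
  have int: "\<psi> (of_int z) = of_int z" for z
  proof (cases z)
    case (neg n)
    have "\<psi> (of_int z) + \<psi> (of_nat (Suc n)) = 0"
      using add[of "of_int z" "of_nat (Suc n)"] zero neg by simp
    then have "\<psi> (of_int z) = - of_nat (Suc n)"
      unfolding nat by (simp only: eq_neg_iff_add_eq_0)
    moreover have "(of_int z :: complex) = - of_nat (Suc n)" using neg by simp
    ultimately show ?thesis by metis
  qed (simp add: nat)
  have "\<psi> x = x" if "x \<in> \<rat>" for x
  proof -
    obtain a b where x: "x = of_int a / of_int b" "b \<noteq> 0"
      using \<open>x \<in> \<rat>\<close> by (auto elim!: Rats_cases')
    then have "x * of_int b = of_int a" by simp
    then have "\<psi> x * of_int b = of_int a"
      using mult[OF that, of "of_int b"] int by simp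
    then have "\<psi> x = of_int a / of_int b"
      using x(2) by (simp add: field_simps)
    then show ?thesis using x(1) by simp
  qed
  then show "\<psi> \<in> {restrict id \<rat>}"
    using ext by (auto simp: fun_eq_iff extensional_def)
next
  fix \<psi> assume "\<psi> \<in> {restrict id (\<rat> :: complex set)}"
  then show "\<psi> \<in> field_embeddings \<rat>"
    by (auto simp: field_embeddings_def ring_hom_def)
qed

lemma places_Rats: "places \<rat> = insert (Real_Place (restrict id \<rat>)) (Finite_Place ` nonzero_primes \<rat>)"
proof -
  have "restrict id \<rat> ` \<rat> \<subseteq> (\<real> :: complex set)"
    by (auto elim!: Rats_cases')
  then show ?thesis
    by (auto simp: places_def field_embeddings_Rats)
qed

section \<open>Height and radical over the rationals\<close>

text \<open>By coprimality every prime fails to divide \<open>a\<close> or \<open>b\<close>, so each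
  finite place has maximum 1 and only the real place contributes.\<close>

lemma abc_height_Rats:
  assumes "a \<noteq> 0" "b \<noteq> 0" "c \<noteq> 0" "coprime a b"
  shows "abc_height \<rat> (of_int a) (of_int b) (of_int c) = real_of_int (max \<bar>a\<bar> (max \<bar>b\<bar> \<bar>c\<bar>))"
proof -
  let ?m = "\<lambda>v. place_max \<rat> v (of_int a) (of_int b) (of_int c)"
  let ?v = "Real_Place (restrict id \<rat>)"
  have finite_place: "?m (Finite_Place \<pp>) = 1" if pp: "\<pp> \<in> nonzero_primes \<rat>" for \<pp>
  proof -
    obtain p where p: "Factorial_Ring.prime p" "\<pp> = int_multiples (int p)"
      using nonzero_primes_Rats[OF pp] by blast
    have "\<not> (int p dvd a \<and> int p dvd b)"
      using assms(4) p(1) coprime_common_divisor not_prime_unit prime_int_nat_transfer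
      by (metis nat_int of_nat_0_le_iff)
    then show ?thesis
      unfolding place_max_def p(2)
      using place_abs_int_multiples[OF p(1) assms(1)] place_abs_int_multiples[OF p(1) assms(2)]
        place_abs_int_multiples[OF p(1) assms(3)] by (auto simp del: place_abs.simps simp: max_def)
  qed
  have real_place: "?m ?v = real_of_int (max \<bar>a\<bar> (max \<bar>b\<bar> \<bar>c\<bar>))"
    by (simp add: place_max_def of_int_max)
  have sub: "{v \<in> places \<rat>. ?m v \<noteq> 1} \<subseteq> {?v}"
    using finite_place by (auto simp: places_Rats)
  have "abc_height \<rat> (of_int a) (of_int b) (of_int c) = (\<Prod>v\<in>{?v}. ?m v)"
    unfolding abc_height_def
  proof (rule prod.mono_neutral_left[OF _ sub])
    have "?v \<in> places \<rat>" by (simp add: places_Rats)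
    then show "\<forall>v\<in>{?v} - {v \<in> places \<rat>. ?m v \<noteq> 1}. ?m v = 1" by blast
  qed simp
  also have "\<dots> = ?m ?v" by simp
  finally show ?thesis using real_place by (rule trans)
qed

text \<open>An upper bound suffices, since the radical stands on the larger side of the abc
  inequality. A contributing ideal lies over a prime dividing \<open>a * b * c\<close>, distinct
  ideals lie over distinct primes, and each factor is at most that prime.\<close>

lemma abc_radical_Rats_le:
  assumes "a \<noteq> 0" "b \<noteq> 0" "c \<noteq> 0"
  shows "abc_radical \<rat> (of_int a) (of_int b) (of_int c) \<le> real (int_radical (a * b * c))"
proof -
  let ?A = "abc_primes \<rat> (of_int a) (of_int b) (of_int c)"
  let ?f = "\<lambda>\<pp>. real (ideal_norm \<rat> \<pp>) powi ord_prime \<rat> \<pp> (of_nat (prime_below \<pp>))"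
  let ?S = "{p. Factorial_Ring.prime p \<and> int p dvd a * b * c}"
  have A: "\<exists>p\<in>?S. \<pp> = int_multiples (int p)" if pp: "\<pp> \<in> ?A" for \<pp>
  proof -
    obtain p where p: "Factorial_Ring.prime p" "\<pp> = int_multiples (int p)"
      using nonzero_primes_Rats pp by (auto simp: abc_primes_def)
    have "int p dvd a \<or> int p dvd b \<or> int p dvd c"
    proof (rule ccontr)
      assume "\<not> ?thesis"
      then have "place_abs \<rat> (Finite_Place \<pp>) (of_int a) = 1" "place_abs \<rat> (Finite_Place \<pp>) (of_int b) = 1"
        "place_abs \<rat> (Finite_Place \<pp>) (of_int c) = 1"
        using p assms place_abs_int_multiples(2) by blast+
      then show False using pp by (simp add: abc_primes_def)
    qed
    then show ?thesis using p by auto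
  qed
  have inj: "inj_on prime_below ?A"
  proof (rule inj_onI)
    fix \<pp> \<qq> assume "\<pp> \<in> ?A" "\<qq> \<in> ?A" and eq: "prime_below \<pp> = prime_below \<qq>"
    then obtain p q where "p \<in> ?S" "\<pp> = int_multiples (int p)" "q \<in> ?S" "\<qq> = int_multiples (int q)"
      using A by meson
    then show "\<pp> = \<qq>" using eq by (simp add: prime_below_int_multiples)
  qed
  have "abc_radical \<rat> (of_int a) (of_int b) (of_int c) = (\<Prod>\<pp>\<in>?A. ?f \<pp>)"
    by (simp add: abc_radical_def)
  also have "\<dots> \<le> (\<Prod>\<pp>\<in>?A. real (prime_below \<pp>))"
  proof (rule prod_mono)
    fix \<pp> assume "\<pp> \<in> ?A"
    then obtain p where p: "Factorial_Ring.prime p" "\<pp> = int_multiples (int p)" using A by blast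
    have "ord_prime \<rat> (int_multiples (int p)) (of_nat p) = 1"
      using ord_prime_int_multiples[OF p(1), of "int p"] prime_gt_0_nat[OF p(1)] p(1) by simp
    then show "0 \<le> ?f \<pp> \<and> ?f \<pp> \<le> real (prime_below \<pp>)"
      using p ideal_norm_int_multiples[of p] prime_gt_0_nat[OF p(1)] by (simp add: prime_below_int_multiples)
  qed
  also have "\<dots> = real (\<Prod>(prime_below ` ?A))"
    using inj by (simp add: prod.reindex)
  also have "\<dots> \<le> real (int_radical (a * b * c))"
    unfolding of_nat_le_iff
  proof (rule dvd_imp_le)
    have "finite ?S" using assms by (intro finite_prime_divisors) auto
    moreover have "prime_below ` ?A \<subseteq> ?S"
    proof (rule image_subsetI)
      fix \<pp> assume "\<pp> \<in> ?A"
      then obtain p where "p \<in> ?S" "\<pp> = int_multiples (int p)" using A by blast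
      then show "prime_below \<pp> \<in> ?S" by (simp add: prime_below_int_multiples)
    qed
    ultimately show "\<Prod>(prime_below ` ?A) dvd int_radical (a * b * c)"
      unfolding int_radical_def by (rule prod_dvd_prod_subset)
    show "0 < int_radical (a * b * c)"
      unfolding int_radical_def by (auto intro!: prod_pos dest: prime_gt_0_nat)
  qed
  finally show ?thesis .
qed

theorem abc_integers:
  assumes "abc_conjecture_number_fields" "\<epsilon> > 0"
  obtains C where "C > 0"
    "\<And>a b c :: int. a \<noteq> 0 \<Longrightarrow> b \<noteq> 0 \<Longrightarrow> c \<noteq> 0 \<Longrightarrow> a + b + c = 0 \<Longrightarrow> coprime a b \<Longrightarrow>
       real_of_int (max \<bar>a\<bar> (max \<bar>b\<bar> \<bar>c\<bar>)) < C * real (int_radical (a * b * c)) powr (1 + \<epsilon>)"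
proof -
  obtain C where C: "C > 0" "\<And>a b c. a \<in> \<rat> - {0} \<Longrightarrow> b \<in> \<rat> - {0} \<Longrightarrow> c \<in> \<rat> - {0} \<Longrightarrow> a + b + c = 0 \<Longrightarrow>
      abc_height \<rat> a b c < C * abc_radical \<rat> a b c powr (1 + \<epsilon>)"
    using assms number_field_Rats unfolding abc_conjecture_number_fields_def by metis
  show ?thesis
  proof (rule that[OF C(1)])
    fix a b c :: int assume abc: "a \<noteq> 0" "b \<noteq> 0" "c \<noteq> 0" "a + b + c = 0" "coprime a b"
    have "real_of_int (max \<bar>a\<bar> (max \<bar>b\<bar> \<bar>c\<bar>)) = abc_height \<rat> (of_int a) (of_int b) (of_int c)"
      using abc by (simp add: abc_height_Rats)
    also have "\<dots> < C * abc_radical \<rat> (of_int a) (of_int b) (of_int c) powr (1 + \<epsilon>)"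
      using abc by (intro C(2)) (auto simp flip: of_int_add)
    also have "\<dots> \<le> C * real (int_radical (a * b * c)) powr (1 + \<epsilon>)"
      using C(1) assms(2) abc
      by (intro mult_left_mono powr_mono2 abc_radical_Rats_le) (auto simp: abc_radical_def intro!: prod_nonneg)
    finally show "real_of_int (max \<bar>a\<bar> (max \<bar>b\<bar> \<bar>c\<bar>)) < C * real (int_radical (a * b * c)) powr (1 + \<epsilon>)" .
  qed
qed

section \<open>Prime divisors of Lucas numbers\<close>

lemma prod_prime_powers_dvd:
  fixes n :: nat
  assumes "finite S" "\<And>p. p \<in> S \<Longrightarrow> Factorial_Ring.prime p \<and> p ^ e p dvd n"
  shows "(\<Prod>p\<in>S. p ^ e p) dvd n"
  using assms
proof (induction S rule: finite_induct)
  case (insert p S)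
  have "coprime (p ^ e p) (\<Prod>q\<in>S. q ^ e q)"
    using insert by (intro prod_coprime_right coprime_power_left_iff[THEN iffD2] coprime_power_right_iff[THEN iffD2] disjI2 disjI1)
      (auto intro!: primes_coprime)
  then have "p ^ e p * (\<Prod>q\<in>S. q ^ e q) dvd n"
    using insert by (intro divides_mult) auto
  then show ?case using insert by simp
qed simp

lemma prod_primes_le:
  assumes "k \<noteq> 0" "\<And>p. p \<in> S \<Longrightarrow> Factorial_Ring.prime p \<and> int p dvd k"
  shows "\<Prod>S \<le> nat \<bar>k\<bar>"
proof (rule dvd_imp_le)
  have "finite S"
    using assms by (intro finite_subset[OF _ finite_prime_divisors[OF assms(1)]]) auto
  then have "(\<Prod>p\<in>S. p ^ 1) dvd nat \<bar>k\<bar>"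
    using assms(2) by (intro prod_prime_powers_dvd) (auto simp: int_dvd_int_iff[symmetric])
  then show "\<Prod>S dvd nat \<bar>k\<bar>" by simp
qed (use assms in simp)

text \<open>The primes of \<open>m\<close> outside \<open>u\<close> all divide \<open>k\<close>, so
  their product is at most \<bar>k\<bar>.\<close>

lemma int_radical_le:
  assumes "k \<noteq> 0" "u \<noteq> 0"
    and "\<And>p. Factorial_Ring.prime p \<Longrightarrow> int p dvd m \<Longrightarrow> int p dvd k \<or> int p dvd u"
  shows "int_radical m \<le> nat \<bar>k\<bar> * int_radical u"
proof -
  let ?S = "\<lambda>m. {p. Factorial_Ring.prime p \<and> int p dvd m}"
  have fin: "finite (?S u)" using assms by (intro finite_prime_divisors)
  have sub: "?S m \<subseteq> (?S m - ?S u) \<union> ?S u" "?S m - ?S u \<subseteq> ?S k"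
    using assms(3) by auto
  have fin': "finite (?S m - ?S u)"
    using sub(2) finite_prime_divisors[OF assms(1)] finite_subset by blast
  have "int_radical m \<le> \<Prod>((?S m - ?S u) \<union> ?S u)"
    unfolding int_radical_def
    by (intro dvd_imp_le prod_dvd_prod_subset prod_pos sub) (use fin fin' in \<open>auto dest: prime_gt_0_nat\<close>)
  also have "\<dots> = \<Prod>(?S m - ?S u) * int_radical u"
    unfolding int_radical_def using fin fin' by (intro prod.union_disjoint) auto
  also have "\<dots> \<le> nat \<bar>k\<bar> * int_radical u"
    using assms sub by (intro mult_right_mono prod_primes_le) auto
  finally show ?thesis .
qed

text \<open>Let S be the set of primes of \<open>u\<close> and A the subset of those whose square
  divides \<open>u\<close>. Multiplying \<Prod>S \<Prod>A \<le> \<bar>u\<bar> by \<Prod>(S - A)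
  \<le> \<bar>M\<bar> gives the squared radical on the left.\<close>

lemma int_radical_square_le:
  assumes "u \<noteq> 0" "M \<noteq> 0"
    and "\<And>p. Factorial_Ring.prime p \<Longrightarrow> int p dvd u \<Longrightarrow> int p ^ 2 dvd u \<or> int p dvd M"
  shows "int_radical u ^ 2 \<le> nat \<bar>u\<bar> * nat \<bar>M\<bar>"
proof -
  define S where "S = {p. Factorial_Ring.prime p \<and> int p dvd u}"
  define A where "A = {p \<in> S. int p ^ 2 dvd u}"
  have S: "finite S" "A \<subseteq> S"
    using finite_prime_divisors[OF assms(1)] by (auto simp: S_def A_def)
  have "(\<Prod>p\<in>S. p ^ (if p \<in> A then 2 else 1)) dvd nat \<bar>u\<bar>"
    using S by (intro prod_prime_powers_dvd) (auto simp: S_def A_def int_dvd_int_iff[symmetric])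
  also have "(\<Prod>p\<in>S. p ^ (if p \<in> A then 2 else 1)) = (\<Prod>p\<in>S. p * (if p \<in> A then p else 1))"
    by (intro prod.cong) (auto simp: power2_eq_square)
  also have "\<dots> = \<Prod>S * \<Prod>A"
    using S by (simp add: prod.distrib prod.inter_restrict[symmetric] Int_absorb1)
  finally have "\<Prod>S * \<Prod>A \<le> nat \<bar>u\<bar>"
    using assms(1) by (intro dvd_imp_le) auto
  moreover have "\<Prod>(S - A) \<le> nat \<bar>M\<bar>"
    using assms by (intro prod_primes_le) (auto simp: S_def A_def)
  ultimately have "(\<Prod>S * \<Prod>A) * \<Prod>(S - A) \<le> nat \<bar>u\<bar> * nat \<bar>M\<bar>"
    by (intro mult_mono) auto
  moreover have "\<Prod>S = \<Prod>(S - A) * \<Prod>A"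
    by (rule prod.subset_diff[OF S(2) S(1)])
  ultimately show ?thesis
    by (simp add: int_radical_def S_def[symmetric] power2_eq_square mult_ac)
qed

text \<open>Applied with \<open>t\<^sup>8\<close> the \<open>n\<close>-th power of the dominant root and \<open>R\<close> the radical of \<open>U\<^sub>n\<close>.\<close>

lemma abc_exponent_contradiction:
  fixes t R c K :: real
  assumes "t > 0" "R \<ge> 0" "c > 0" "K > 0" and R: "R ^ 2 \<le> K * t ^ 9"
    and abc: "t ^ 16 < c * (t ^ 8 * R) powr (1 + 1 / 5)"
  shows "t < c * K powr (3 / 5)"
proof -
  define y where "y = t ^ 8 * R"
  have "y \<noteq> 0"
    using abc assms(1) unfolding y_def[symmetric] by (cases "y = 0") auto
  moreover have "y \<ge> 0" using assms by (simp add: y_def)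
  ultimately have y: "y > 0" by simp
  have "y ^ 2 = t ^ 16 * R ^ 2"
    by (simp add: y_def power_mult_distrib flip: power_mult)
  also have "\<dots> \<le> t ^ 16 * (K * t ^ 9)"
    using assms(1) by (intro mult_left_mono R) auto
  also have "\<dots> = K * t ^ 25"
    by (simp flip: power_add)
  also have "t ^ 25 = t powr 25"
    using assms(1) powr_realpow[of t 25] by simp
  finally have *: "y powr 2 \<le> K * t powr 25"
    using y powr_realpow[of y 2] by simp
  \<comment> \<open>As 6/5 = 2 * 3/5 and 25 * 3/5 = 15, the bound on y^2 leaves exactly one power of
    \<open>t\<close> missing against t^16.\<close>
  have "y powr (1 + 1 / 5) = (y powr 2) powr (3 / 5)"
    by (simp add: powr_powr del: powr_numeral)
  also have "\<dots> \<le> (K * t powr 25) powr (3 / 5)"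
    using * by (intro powr_mono2) auto
  also have "\<dots> = K powr (3 / 5) * t powr 15"
    using assms(1,4) by (simp add: powr_mult powr_powr del: powr_numeral)
  also have "t powr 15 = t ^ 15"
    using assms(1) powr_realpow[of t 15] by simp
  finally have "c * y powr (1 + 1 / 5) \<le> c * (K powr (3 / 5) * t ^ 15)"
    using assms(3) by (rule mult_left_mono[OF _ less_imp_le])
  then have "t ^ 16 < c * (K powr (3 / 5) * t ^ 15)"
    using abc unfolding y_def by linarith
  moreover have "t ^ 16 = t * t ^ 15" by (simp flip: power_Suc)
  ultimately have "t * t ^ 15 < (c * K powr (3 / 5)) * t ^ 15"
    by (simp only: mult.assoc)
  then show ?thesis
    using assms(1) by (simp only: mult_less_cancel_right_pos zero_less_power)
qed

section \<open>Roots, growth and the companion sequence\<close>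

locale lucas_pair =
  fixes P Q :: int
  assumes P: "P \<noteq> 0" and Q: "Q \<noteq> 0" and cop: "coprime P Q" and disc_pos: "lucas_disc P Q > 0"
begin

abbreviation U :: "nat \<Rightarrow> int" where "U \<equiv> lucas_U P Q"

abbreviation disc :: int where "disc \<equiv> lucas_disc P Q"

definition V :: "nat \<Rightarrow> int" where "V n = 2 * U (Suc n) - P * U n"

definition \<alpha> :: real where "\<alpha> = (of_int P + sqrt (of_int disc)) / 2"
definition \<beta> :: real where "\<beta> = (of_int P - sqrt (of_int disc)) / 2"

text \<open>The larger absolute value of the roots. With the signs fixed as above, \<alpha>
  dominates for P > 0 and \<beta> for P < 0.\<close>

definition dominant :: real where "dominant = (of_int \<bar>P\<bar> + sqrt (of_int disc)) / 2"

lemma sqrt_disc_ge_1: "1 \<le> sqrt (of_int disc)"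
  using disc_pos by simp

lemma root_squares: "\<alpha> ^ 2 = of_int P * \<alpha> - of_int Q" "\<beta> ^ 2 = of_int P * \<beta> - of_int Q"
proof -
  have "sqrt (of_int disc) ^ 2 = real_of_int disc"
    using disc_pos by simp
  also have "\<dots> = of_int P ^ 2 - 4 * of_int Q"
    by (simp add: lucas_disc_def)
  finally show "\<alpha> ^ 2 = of_int P * \<alpha> - of_int Q" "\<beta> ^ 2 = of_int P * \<beta> - of_int Q"
    by (simp_all add: \<alpha>_def \<beta>_def power2_eq_square field_simps)
qed

lemma binet: "sqrt (of_int disc) * of_int (U n) = \<alpha> ^ n - \<beta> ^ n"
proof (induction n rule: induct_nat_012)
  case 1
  then show ?case by (simp add: \<alpha>_def \<beta>_def field_simps)
next
  case (ge2 n)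
  have "sqrt (of_int disc) * of_int (U (Suc (Suc n))) =
      of_int P * (\<alpha> ^ Suc n - \<beta> ^ Suc n) - of_int Q * (\<alpha> ^ n - \<beta> ^ n)"
    unfolding ge2[symmetric] by (simp add: algebra_simps)
  also have "\<dots> = \<alpha> ^ n * (of_int P * \<alpha> - of_int Q) - \<beta> ^ n * (of_int P * \<beta> - of_int Q)"
    by (simp add: algebra_simps)
  also have "\<dots> = \<alpha> ^ Suc (Suc n) - \<beta> ^ Suc (Suc n)"
    unfolding root_squares[symmetric] by (simp add: power2_eq_square algebra_simps)
  finally show ?case .
qed simp

lemma binet_V: "of_int (V n) = \<alpha> ^ n + \<beta> ^ n"
proof -
  have "sqrt (of_int disc) * of_int (V n) =
      2 * (sqrt (of_int disc) * of_int (U (Suc n))) - of_int P * (sqrt (of_int disc) * of_int (U n))"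
    by (simp add: V_def algebra_simps)
  also have "\<dots> = (2 * \<alpha> - of_int P) * \<alpha> ^ n - (2 * \<beta> - of_int P) * \<beta> ^ n"
    unfolding binet by (simp add: algebra_simps)
  also have "\<dots> = sqrt (of_int disc) * (\<alpha> ^ n + \<beta> ^ n)"
    by (simp add: \<alpha>_def \<beta>_def algebra_simps)
  finally show ?thesis using sqrt_disc_ge_1 by (simp only: mult_cancel_left) simp
qed

text \<open>Equivalent to U_{n+1}^2 - P U_{n+1} U_n + Q U_n^2 = Q^n, whose left side is multiplied
  by Q when n increases by 1.\<close>

lemma V_square: "V n ^ 2 - disc * U n ^ 2 = 4 * Q ^ n"
proof -
  have "U (Suc n) ^ 2 - P * U (Suc n) * U n + Q * U n ^ 2 = Q ^ n"
  proof (induction n)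
    case (Suc n)
    have "U (Suc (Suc n)) ^ 2 - P * U (Suc (Suc n)) * U (Suc n) + Q * U (Suc n) ^ 2 =
        Q * (U (Suc n) ^ 2 - P * U (Suc n) * U n + Q * U n ^ 2)"
      by (simp add: power2_eq_square algebra_simps)
    then show ?case unfolding Suc by simp
  qed simp
  then show ?thesis
    by (simp add: V_def lucas_disc_def power2_eq_square algebra_simps)
qed

text \<open>For \<bar>P\<bar> = 1 the conditions Q \<noteq> 0 and \<Delta> = 1 - 4 Q > 0 force
  \<Delta> > 1; otherwise \<surd>\<Delta> \<ge> 1 is enough.\<close>

lemma dominant_gt_1: "1 < dominant"
proof (cases "\<bar>P\<bar> \<ge> 2")
  case True
  then have "real_of_int \<bar>P\<bar> \<ge> 2" by linarith
  moreover have "1 < (x + y) / 2" if "2 \<le> x" "1 \<le> y" for x y :: real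
    using that by simp
  ultimately show ?thesis
    unfolding dominant_def using sqrt_disc_ge_1 by blast
next
  case False
  then have "\<bar>P\<bar> = 1" using P by linarith
  then have "disc = 1 - 4 * Q"
    by (simp add: lucas_disc_def power2_eq_1_iff[THEN iffD2] abs_eq_iff')
  then have "disc > 1" using disc_pos Q by linarith
  then have "sqrt (of_int disc) > 1" by simp
  then show ?thesis using \<open>\<bar>P\<bar> = 1\<close> by (simp add: dominant_def)
qed

lemma roots_le_dominant: "\<bar>\<alpha>\<bar> \<le> dominant" "\<bar>\<beta>\<bar> \<le> dominant"
proof -
  have "\<bar>(x + s) / 2\<bar> \<le> (\<bar>x\<bar> + s) / 2" "\<bar>(x - s) / 2\<bar> \<le> (\<bar>x\<bar> + s) / 2" if "1 \<le> s" for x s :: real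
    using that by (auto simp: abs_if)
  then show "\<bar>\<alpha>\<bar> \<le> dominant" "\<bar>\<beta>\<bar> \<le> dominant"
    unfolding \<alpha>_def \<beta>_def dominant_def of_int_abs using sqrt_disc_ge_1 by blast+
qed

lemma dominant_root: "dominant = \<alpha> \<or> dominant = - \<beta>"
  by (cases "P \<ge> 0") (simp_all add: \<alpha>_def \<beta>_def dominant_def)

lemma roots_power_le: "\<bar>\<alpha> ^ n\<bar> \<le> dominant ^ n" "\<bar>\<beta> ^ n\<bar> \<le> dominant ^ n"
  unfolding power_abs using roots_le_dominant by (auto intro: power_mono)

lemma abs_V_le: "of_int \<bar>V n\<bar> \<le> 2 * dominant ^ n"
  using roots_power_le[of n] abs_triangle_ineq[of "\<alpha> ^ n" "\<beta> ^ n"] by (simp add: binet_V)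

lemma abs_U_le: "of_int \<bar>U n\<bar> \<le> 2 * dominant ^ n"
proof -
  have "of_int \<bar>U n\<bar> \<le> sqrt (of_int disc) * of_int \<bar>U n\<bar>"
    using sqrt_disc_ge_1 mult_right_mono[of 1 "sqrt (of_int disc)" "of_int \<bar>U n\<bar>"] by simp
  also have "\<dots> = \<bar>\<alpha> ^ n - \<beta> ^ n\<bar>"
    unfolding binet[symmetric] using sqrt_disc_ge_1 by (simp add: abs_mult)
  also have "\<dots> \<le> 2 * dominant ^ n"
    using roots_power_le[of n] by linarith
  finally show ?thesis .
qed

text \<open>The two squares add up to 2 (\<alpha>^(2n) + \<beta>^(2n)), so one of them is at least
  half of that. This replaces separate lower bounds for U_n and V_n.\<close>

lemma U_V_squares_ge: "dominant ^ (2 * n) \<le> max (of_int (V n ^ 2)) (of_int (disc * U n ^ 2))"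
proof -
  have "real_of_int (disc * U n ^ 2) = (sqrt (of_int disc) * of_int (U n)) ^ 2"
    using disc_pos by (simp add: power_mult_distrib)
  then have "real_of_int (disc * U n ^ 2) = (\<alpha> ^ n - \<beta> ^ n) ^ 2"
    by (simp only: binet)
  moreover have "real_of_int (V n ^ 2) = (\<alpha> ^ n + \<beta> ^ n) ^ 2"
    by (simp only: of_int_power binet_V)
  moreover have "(x + y) ^ 2 + (x - y) ^ 2 = 2 * (x ^ 2 + y ^ 2)" for x y :: real
    by (simp add: power2_eq_square algebra_simps)
  ultimately have "real_of_int (V n ^ 2) + real_of_int (disc * U n ^ 2) = 2 * ((\<alpha> ^ n) ^ 2 + (\<beta> ^ n) ^ 2)"
    by (simp only:)
  moreover have "dominant ^ (2 * n) = (\<alpha> ^ n) ^ 2 \<or> dominant ^ (2 * n) = (\<beta> ^ n) ^ 2"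
  proof -
    have "dominant ^ 2 = \<alpha> ^ 2 \<or> dominant ^ 2 = \<beta> ^ 2"
      using dominant_root by auto
    moreover have "x ^ (2 * n) = (x ^ 2) ^ n" "(x ^ n) ^ 2 = (x ^ 2) ^ n" for x :: real
      by (simp_all only: power_mult[symmetric] mult.commute[of n 2])
    ultimately show ?thesis by metis
  qed
  moreover have "x \<le> max u v" if "u + v = 2 * (y ^ 2 + z ^ 2)" "x = y ^ 2 \<or> x = z ^ 2" for x y z u v :: real
    using that zero_le_power2[of y] zero_le_power2[of z] by (smt (verit))
  ultimately show ?thesis by blast
qed

text \<open>Equality would give \<alpha>^2 = \<beta>^2, but \<alpha>^2 - \<beta>^2 = P
  \<surd>\<Delta>. It excludes zeros of U_n and V_n for positive n.\<close>

lemma abs_roots_power_neq: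
  assumes "n > 0"
  shows "\<bar>\<alpha> ^ n\<bar> \<noteq> \<bar>\<beta> ^ n\<bar>"
proof
  assume "\<bar>\<alpha> ^ n\<bar> = \<bar>\<beta> ^ n\<bar>"
  then have "\<bar>\<alpha>\<bar> = \<bar>\<beta>\<bar>"
    using assms power_eq_imp_eq_base[of "\<bar>\<alpha>\<bar>" n "\<bar>\<beta>\<bar>"] by (simp add: power_abs)
  then have "\<alpha> ^ 2 = \<beta> ^ 2" by (metis power2_abs)
  then have "of_int P * sqrt (of_int disc) = 0"
    by (simp add: \<alpha>_def \<beta>_def power2_eq_square field_simps)
  then show False using P sqrt_disc_ge_1 by simp
qed

lemma U_nonzero: "n > 0 \<Longrightarrow> U n \<noteq> 0"
  using abs_roots_power_neq[of n] binet[of n] by auto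

lemma V_nonzero: "n > 0 \<Longrightarrow> V n \<noteq> 0"
  using abs_roots_power_neq[of n] binet_V[of n] by (auto simp: add_eq_0_iff)

text \<open>For positive n, V_n is congruent to P^n modulo Q.\<close>

lemma coprime_V_Q:
  assumes "n > 0"
  shows "coprime (V n) Q"
proof -
  obtain m where m: "n = Suc m" using assms by (cases n) auto
  have "[2 * U (Suc n) - P * U n = 2 * P ^ n - P * P ^ m] (mod Q)"
    unfolding m by (intro cong_diff cong_mult cong_refl lucas_U_cong_power)
  moreover have "2 * P ^ n - P * P ^ m = P ^ n" by (simp add: m)
  ultimately have "[P ^ n = V n] (mod Q)"
    unfolding V_def using cong_sym by metis
  moreover have "coprime (P ^ n) Q" using cop by simp
  ultimately show ?thesis by (rule cong_imp_coprime)
qed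

text \<open>A cruder base than \<open>dominant\<close>, but without a leading factor 2, which would
  accumulate in products over many indices.\<close>

lemma abs_U_le_power: "\<bar>U n\<bar> \<le> (\<bar>P\<bar> + \<bar>Q\<bar>) ^ n"
proof (induction n rule: induct_nat_012)
  case 1
  then show ?case using P Q by simp
next
  case (ge2 n)
  have "(\<bar>P\<bar> + \<bar>Q\<bar>) ^ n \<le> (\<bar>P\<bar> + \<bar>Q\<bar>) ^ Suc n"
    using P Q by (intro power_increasing) auto
  then have "\<bar>U n\<bar> \<le> (\<bar>P\<bar> + \<bar>Q\<bar>) ^ Suc n" using ge2(1) by linarith
  then have "\<bar>P\<bar> * \<bar>U (Suc n)\<bar> + \<bar>Q\<bar> * \<bar>U n\<bar> \<le> \<bar>P\<bar> * (\<bar>P\<bar> + \<bar>Q\<bar>) ^ Suc n + \<bar>Q\<bar> * (\<bar>P\<bar> + \<bar>Q\<bar>) ^ Suc n"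
    using ge2(2) by (intro add_mono mult_left_mono) auto
  moreover have "\<bar>U (Suc (Suc n))\<bar> \<le> \<bar>P\<bar> * \<bar>U (Suc n)\<bar> + \<bar>Q\<bar> * \<bar>U n\<bar>"
    using abs_triangle_ineq4[of "P * U (Suc n)" "Q * U n"] by (simp add: abs_mult)
  ultimately show ?case by (simp add: distrib_right)
qed simp

text \<open>The triple is \<open>V\<^sub>n\<^sup>2\<close>, \<open>-\<Delta> U\<^sub>n\<^sup>2\<close>, \<open>-4 Q\<^sup>n\<close>. As \<open>V\<^sub>n\<close> is prime to \<open>Q\<close>, the
  common divisor that has to be removed divides 4.\<close>

lemma abc_radical_lower_bound:
  assumes "abc_conjecture_number_fields" "\<epsilon> > 0"
  obtains c where "c > 0"
    "\<And>n. n > 0 \<Longrightarrow> dominant ^ (2 * n) < c * (dominant ^ n * real (int_radical (U n))) powr (1 + \<epsilon>)"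
proof -
  obtain C where C: "C > 0"
    "\<And>a b c :: int. a \<noteq> 0 \<Longrightarrow> b \<noteq> 0 \<Longrightarrow> c \<noteq> 0 \<Longrightarrow> a + b + c = 0 \<Longrightarrow> coprime a b \<Longrightarrow>
       real_of_int (max \<bar>a\<bar> (max \<bar>b\<bar> \<bar>c\<bar>)) < C * real (int_radical (a * b * c)) powr (1 + \<epsilon>)"
    using abc_integers[OF assms] by blast
  \<comment> \<open>Primes of the reduced triple divide V_n * 2 Q \<Delta> or U_n. Together with
    \<bar>V_n\<bar> \<le> 2 dominant^n this gives the factor 2 * 2 \<bar>Q\<bar> \<Delta>.\<close>
  define K where "K = 4 * real_of_int (\<bar>Q\<bar> * disc)"
  have K: "K > 0" using Q disc_pos by (simp add: K_def)
  show ?thesis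
  proof (rule that)
    show "4 * C * K powr (1 + \<epsilon>) > 0" using C(1) K by simp
  next
    fix n :: nat assume n: "n > 0"
    define g where "g = gcd (V n ^ 2) (4 * Q ^ n)"
    have g0: "g > 0" using V_nonzero[OF n] by (simp add: g_def)
    obtain x w where xw: "V n ^ 2 = x * g" "4 * Q ^ n = w * g" "coprime x w"
      using gcd_coprime_exists[of "V n ^ 2" "4 * Q ^ n"] g0 unfolding g_def by auto
    have y: "disc * U n ^ 2 = (x - w) * g"
      using V_square[of n] xw by (simp add: algebra_simps)
    have "coprime g (Q ^ n)"
      using coprime_V_Q[OF n] coprime_divisors[of g "V n ^ 2" "Q ^ n" "Q ^ n"] by (simp add: g_def)
    then have "g dvd 4"
      using coprime_dvd_mult_left_iff[of g "Q ^ n" 4] by (simp add: g_def)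
    then have g4: "g \<le> 4" by (simp add: zdvd_imp_le)
    have nz: "x \<noteq> 0" "- w \<noteq> 0" "- (x - w) \<noteq> 0"
      using xw y V_nonzero[OF n] U_nonzero[OF n] Q disc_pos by auto
    define H where "H = max \<bar>x\<bar> (max \<bar>- w\<bar> \<bar>- (x - w)\<bar>)"
    have H: "x \<le> H" "x - w \<le> H" "0 \<le> H" by (auto simp: H_def)
    have h: "real_of_int H < C * real (int_radical (x * - w * - (x - w))) powr (1 + \<epsilon>)"
      unfolding H_def using nz xw(3) by (intro C(2)) auto
    have V2: "V n ^ 2 \<le> 4 * H"
    proof -
      have "x * g \<le> H * 4"
        using g0 g4 H by (intro mult_mono) auto
      then show ?thesis using xw by simp
    qed
    have U2: "disc * U n ^ 2 \<le> 4 * H"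
    proof -
      have "(x - w) * g \<le> H * 4"
        using g0 g4 H by (intro mult_mono) auto
      then show ?thesis using y by simp
    qed
    have "dominant ^ (2 * n) \<le> max (of_int (V n ^ 2)) (of_int (disc * U n ^ 2))"
      by (rule U_V_squares_ge)
    also have "\<dots> \<le> 4 * real_of_int H"
    proof (rule max.boundedI)
      show "real_of_int (V n ^ 2) \<le> 4 * real_of_int H"
        using V2 by (metis of_int_le_iff of_int_mult of_int_numeral)
      show "real_of_int (disc * U n ^ 2) \<le> 4 * real_of_int H"
        using U2 by (metis of_int_le_iff of_int_mult of_int_numeral)
    qed
    also have "\<dots> < 4 * (C * real (int_radical (x * - w * - (x - w))) powr (1 + \<epsilon>))"
      using h by simp
    also have "\<dots> \<le> 4 * (C * (K * (dominant ^ n * real (int_radical (U n)))) powr (1 + \<epsilon>))"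
    proof -
      have "int_radical (x * - w * - (x - w)) \<le> nat \<bar>V n * (2 * Q * disc)\<bar> * int_radical (U n)"
      proof (rule int_radical_le)
        fix p assume p: "Factorial_Ring.prime p" "int p dvd x * - w * - (x - w)"
        have pp: "prime_elem (int p)"
          using p(1) prime_nat_int_transfer prime_imp_prime_elem by blast
        from p(2) have "int p dvd x \<or> int p dvd w \<or> int p dvd x - w"
          unfolding prime_elem_dvd_mult_iff[OF pp] dvd_minus_iff by blast
        then have "int p dvd V n ^ 2 \<or> int p dvd 4 * Q ^ n \<or> int p dvd disc * U n ^ 2"
          unfolding xw y by auto
        moreover have "int p dvd 2" if "int p dvd 4"
          using prime_elem_dvd_power[OF pp, of 2 2] that by simp
        ultimately show "int p dvd V n * (2 * Q * disc) \<or> int p dvd U n"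
          unfolding prime_elem_dvd_mult_iff[OF pp] using prime_elem_dvd_power[OF pp] by blast
      qed (use Q disc_pos V_nonzero[OF n] U_nonzero[OF n] in auto)
      then have "real (int_radical (x * - w * - (x - w))) \<le> real_of_int \<bar>V n * (2 * Q * disc)\<bar> * real (int_radical (U n))"
        by (metis of_nat_le_iff of_nat_mult of_nat_nat abs_ge_zero of_int_of_nat_eq)
      also have "\<dots> = of_int \<bar>V n\<bar> * (K / 2 * real (int_radical (U n)))"
        using disc_pos by (simp add: K_def abs_mult)
      also have "\<dots> \<le> (2 * dominant ^ n) * (K / 2 * real (int_radical (U n)))"
        using K abs_V_le[of n] by (intro mult_right_mono) auto
      also have "\<dots> = K * (dominant ^ n * real (int_radical (U n)))" by simp
      finally show ?thesis
        using C(1) assms(2) by (intro mult_left_mono powr_mono2) auto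
    qed
    also have "\<dots> = 4 * C * K powr (1 + \<epsilon>) * (dominant ^ n * real (int_radical (U n))) powr (1 + \<epsilon>)"
      using K dominant_gt_1 by (simp add: powr_mult)
    finally show "dominant ^ (2 * n) < 4 * C * K powr (1 + \<epsilon>) * (dominant ^ n * real (int_radical (U n))) powr (1 + \<epsilon>)" .
  qed
qed

text \<open>If all primes dividing \<open>U\<^sub>n\<close> were excluded, the radical \<open>R\<close> of \<open>U\<^sub>n\<close> would satisfy
  \<open>R\<^sup>2 \<le> \<bar>U\<^sub>n\<bar> \<cdot> 2\<Delta> \<cdot> \<Prod>\<^sub>d \<bar>U\<^bsub>n/d\<^esub>\<bar>\<close>, because \<open>R\<close> times the product of the primes whose square divides
  \<open>U\<^sub>n\<close> is at most \<open>\<bar>U\<^sub>n\<bar>\<close>. The value of \<open>\<delta>\<close> makes the last factor at most the power \<open>n/8\<close> of the dominant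
  root, too small for the \<open>abc\<close> lower bound with \<open>\<epsilon> = 1/5\<close>.\<close>

lemma new_prime_divisor:
  assumes "abc_conjecture_number_fields"
  obtains \<delta> n0 where "\<delta> > 0"
    "\<And>n D. n \<ge> n0 \<Longrightarrow> n > 0 \<Longrightarrow> finite D \<Longrightarrow> (\<And>d. d \<in> D \<Longrightarrow> d dvd n) \<Longrightarrow> (\<Sum>d\<in>D. 1 / real d) \<le> \<delta> \<Longrightarrow>
      \<exists>p. Factorial_Ring.prime p \<and> int p dvd U n \<and> \<not> int p ^ 2 dvd U n \<and> \<not> int p dvd 2 * disc \<and>
        (\<forall>d\<in>D. \<not> int p dvd U (n div d))"
proof -
  obtain c where c: "c > 0"
    "\<And>n. n > 0 \<Longrightarrow> dominant ^ (2 * n) < c * (dominant ^ n * real (int_radical (U n))) powr (1 + 1 / 5)"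
    using abc_radical_lower_bound[OF assms, of "1 / 5"] by auto
  define E where "E = real_of_int (\<bar>P\<bar> + \<bar>Q\<bar>)"
  have "\<bar>P\<bar> + \<bar>Q\<bar> \<ge> 2" using P Q by linarith
  then have E: "E > 1" unfolding E_def by linarith
  define \<delta> where "\<delta> = ln dominant / (8 * ln E)"
  have \<delta>: "\<delta> > 0" using E dominant_gt_1 by (simp add: \<delta>_def)
  have E\<delta>: "E powr (x * \<delta>) = dominant powr (x / 8)" for x
    using E dominant_gt_1 by (simp add: powr_def \<delta>_def)
  \<comment> \<open>The bound of \<open>abc_exponent_contradiction\<close> for K = 4 \<Delta>;
    \<open>n0\<close> is the point from which dominant^(n/8) reaches it.\<close>
  define c' where "c' = c * (4 * real_of_int disc) powr (3 / 5)"
  have c': "c' > 0" using c(1) disc_pos by (simp add: c'_def)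
  define n0 where "n0 = nat \<lceil>8 * log dominant c'\<rceil>"
  show ?thesis
  proof (rule that[OF \<delta>])
    fix n D
    assume n: "n \<ge> n0" "n > 0" and D: "finite D" "\<And>d. d \<in> D \<Longrightarrow> d dvd n" "(\<Sum>d\<in>D. 1 / real d) \<le> \<delta>"
    show "\<exists>p. Factorial_Ring.prime p \<and> int p dvd U n \<and> \<not> int p ^ 2 dvd U n \<and> \<not> int p dvd 2 * disc \<and>
        (\<forall>d\<in>D. \<not> int p dvd U (n div d))"
    proof (rule ccontr)
      assume "\<not> ?thesis"
      then have all: "int p ^ 2 dvd U n \<or> int p dvd 2 * disc \<or> (\<exists>d\<in>D. int p dvd U (n div d))"
        if "Factorial_Ring.prime p" "int p dvd U n" for p using that by blast
      define M where "M = 2 * disc * (\<Prod>d\<in>D. U (n div d))"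
      have div_pos: "n div d > 0" if "d \<in> D" for d
        using D(2)[OF that] n(2) by (metis dvd_div_eq_0_iff neq0_conv)
      have M0: "M \<noteq> 0"
        unfolding M_def using disc_pos D(1) U_nonzero[OF div_pos] by auto
      have "int_radical (U n) ^ 2 \<le> nat \<bar>U n\<bar> * nat \<bar>M\<bar>"
      proof (rule int_radical_square_le[OF U_nonzero[OF n(2)] M0])
        fix p assume "Factorial_Ring.prime p" "int p dvd U n"
        from all[OF this] show "int p ^ 2 dvd U n \<or> int p dvd M"
          unfolding M_def using D(1) by (meson dvd_mult dvd_mult2 dvd_prodI dvd_trans)
      qed
      then have "real (int_radical (U n) ^ 2) \<le> real (nat \<bar>U n\<bar> * nat \<bar>M\<bar>)"
        by (rule of_nat_mono)
      then have 1: "real (int_radical (U n)) ^ 2 \<le> of_int \<bar>U n\<bar> * of_int \<bar>M\<bar>"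
        by simp
      have "of_int \<bar>M\<bar> = 2 * of_int disc * (\<Prod>d\<in>D. real_of_int \<bar>U (n div d)\<bar>)"
        using disc_pos by (simp add: M_def abs_mult abs_prod)
      also have "(\<Prod>d\<in>D. real_of_int \<bar>U (n div d)\<bar>) \<le> (\<Prod>d\<in>D. E ^ (n div d))"
      proof (rule prod_mono)
        fix d
        have "real_of_int \<bar>U (n div d)\<bar> \<le> E ^ (n div d)"
          unfolding E_def using abs_U_le_power by (metis of_int_le_iff of_int_power)
        then show "0 \<le> real_of_int \<bar>U (n div d)\<bar> \<and> real_of_int \<bar>U (n div d)\<bar> \<le> E ^ (n div d)"
          by simp
      qed
      also have "(\<Prod>d\<in>D. E ^ (n div d)) = E powr (\<Sum>d\<in>D. real (n div d))"
        using E powr_realpow[of E "\<Sum>d\<in>D. n div d"] by (simp add: power_sum)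
      also have "(\<Sum>d\<in>D. real (n div d)) = real n * (\<Sum>d\<in>D. 1 / real d)"
        unfolding sum_distrib_left using D(2) by (intro sum.cong) (auto simp: real_of_nat_div)
      also have "E powr (real n * (\<Sum>d\<in>D. 1 / real d)) \<le> E powr (real n * \<delta>)"
        using E D(3) by (intro powr_mono mult_left_mono) auto
      finally have 2: "of_int \<bar>M\<bar> \<le> 2 * of_int disc * dominant powr (n / 8)"
        unfolding E\<delta> using disc_pos by simp
      define t where "t = dominant powr (n / 8)"
      have t0: "t > 0" using dominant_gt_1 by (simp add: t_def)
      have t8: "dominant ^ n = t ^ 8"
        using dominant_gt_1 by (simp add: t_def powr_power powr_realpow)
      \<comment> \<open>Here \<bar>U_n\<bar> \<le> 2 t^8 and \<bar>M\<bar> \<le> 2 \<Delta>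
        t.\<close>
      have "real (int_radical (U n)) ^ 2 \<le> (2 * dominant ^ n) * (2 * of_int disc * t)"
        unfolding t_def using dominant_gt_1 by (intro order.trans[OF 1] mult_mono abs_U_le 2) auto
      also have "\<dots> = 4 * of_int disc * t ^ 9"
        unfolding t8 using power_Suc2[of t 8] by simp
      finally have R: "real (int_radical (U n)) ^ 2 \<le> 4 * of_int disc * t ^ 9" .
      have "dominant ^ (2 * n) = t ^ 16"
        unfolding power_even_eq t8 by (simp flip: power_mult)
      then have "t ^ 16 < c * (t ^ 8 * real (int_radical (U n))) powr (1 + 1 / 5)"
        using c(2)[OF n(2)] unfolding t8 by simp
      then have "t < c'"
        unfolding c'_def using t0 c(1) disc_pos R by (intro abc_exponent_contradiction) auto
      moreover have "c' \<le> t"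
      proof -
        have "8 * log dominant c' \<le> real n" using n(1) unfolding n0_def by linarith
        then have "dominant powr (log dominant c') \<le> dominant powr (n / 8)"
          using dominant_gt_1 by (intro powr_mono) auto
        then show ?thesis using c' dominant_gt_1 by (simp add: t_def)
      qed
      ultimately show False by simp
    qed
  qed
qed

end

section \<open>Divisor sums\<close>

text \<open>Each prime of \<open>k\<close> occurs in \<open>d\<close> at most j - 1 times. Comparing
  multiplicities, \<open>d\<close> already divides k^(j-1) m, which leaves one factor
  \<open>k\<close> over.\<close>

lemma dvd_div_of_prime_powers_not_dvd:
  fixes k m d :: nat
  assumes "j > 0" "k > 0" "m > 0" "d dvd k ^ j * m"
    and no: "\<And>q. Factorial_Ring.prime q \<Longrightarrow> q dvd k \<Longrightarrow> \<not> q ^ j dvd d"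
  shows "k dvd k ^ j * m div d"
proof -
  have d: "d \<noteq> 0" using assms by (metis dvd_0_left_iff mult_eq_0_iff neq0_conv power_not_zero)
  have "d dvd k ^ (j - 1) * m"
  proof (rule multiplicity_le_imp_dvd[OF d])
    fix p :: nat assume p: "Factorial_Ring.prime p"
    have pe: "prime_elem p" using p by (rule prime_imp_prime_elem)
    have mult: "multiplicity p (k ^ i * m) = i * multiplicity p k + multiplicity p m" for i
      using assms pe by (simp add: prime_elem_multiplicity_mult_distrib prime_elem_multiplicity_power_distrib)
    show "multiplicity p d \<le> multiplicity p (k ^ (j - 1) * m)"
    proof (cases "p dvd k")
      case True
      have "multiplicity p d < j"
        using no[OF p True] multiplicity_dvd'[of j p d] by (meson not_less)
      moreover have "1 \<le> multiplicity p k"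
        using True p assms(2) by (simp add: prime_multiplicity_gt_zero_iff Suc_leI)
      then have "(j - 1) * 1 \<le> (j - 1) * multiplicity p k" by (intro mult_left_mono) auto
      ultimately show ?thesis unfolding mult by linarith
    next
      case False
      have "multiplicity p d \<le> multiplicity p (k ^ j * m)"
        using assms by (intro dvd_imp_multiplicity_le) auto
      then show ?thesis unfolding mult using False by (simp add: not_dvd_imp_multiplicity_0)
    qed
  qed
  then obtain e where e: "k ^ (j - 1) * m = d * e" by (elim dvdE)
  have "k ^ j * m = k * (k ^ (j - 1) * m)"
    using assms(1) by (simp add: power_eq_if)
  then have "k ^ j * m = d * (k * e)" unfolding e by simp
  then have "k ^ j * m div d = k * e" using d by (metis nonzero_mult_div_cancel_left)
  then show ?thesis by simp
qed

section \<open>Divisor sums on average\<close>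

definition large_divisor_sum :: "nat \<Rightarrow> nat \<Rightarrow> real" where
  "large_divisor_sum B n = (\<Sum>d | d dvd n \<and> B \<le> d. 1 / real d)"

text \<open>Telescoping, from 1/d^2 \<le> 1/(d-1) - 1/d.\<close>

lemma sum_inverse_squares_le:
  assumes "B > 1"
  shows "(\<Sum>d = B..<B + i. 1 / real d ^ 2) \<le> 1 / real (B - 1) - 1 / real (B + i - 1)"
proof (induction i)
  case (Suc i)
  define x where "x = real (B + i)"
  have x: "x > 1" "real (B + i - 1) = x - 1" "real (B + Suc i - 1) = x"
    using assms by (auto simp: x_def of_nat_diff)
  have "1 / x ^ 2 \<le> 1 / (x - 1) - 1 / x"
    using x(1) by (simp add: field_simps power2_eq_square)
  then show ?case using Suc x(2,3) by (simp add: x_def)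
qed simp

text \<open>Interchanging the sums, each d \<ge> B contributes 1/d for at most N/d multiples, in
  total at most N/d^2. The range of \<open>d\<close> below B + N contains all divisors that
  occur.\<close>

lemma sum_large_divisor_sum_le:
  assumes "B > 1"
  shows "(\<Sum>n = 1..N. large_divisor_sum B n) \<le> real N / real (B - 1)"
proof -
  have "(\<Sum>n = 1..N. large_divisor_sum B n) = (\<Sum>n\<in>{1..N}. \<Sum>d | d \<in> {B..<B + N} \<and> d dvd n. 1 / real d)"
    unfolding large_divisor_sum_def
  proof (intro sum.cong refl)
    fix n assume "n \<in> {1..N}"
    then show "{d. d dvd n \<and> B \<le> d} = {d. d \<in> {B..<B + N} \<and> d dvd n}"
      using assms by (auto dest: dvd_imp_le)
  qed
  also have "\<dots> = (\<Sum>d\<in>{B..<B + N}. \<Sum>n | n \<in> {1..N} \<and> d dvd n. 1 / real d)"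
    by (rule sum.swap_restrict) auto
  also have "\<dots> \<le> (\<Sum>d\<in>{B..<B + N}. real N * (1 / real d ^ 2))"
  proof (rule sum_mono)
    fix d assume "d \<in> {B..<B + N}"
    then have d: "d > 0" using assms by auto
    have "{n. n \<in> {1..N} \<and> d dvd n} \<subseteq> (\<lambda>i. d * i) ` {1..N div d}"
    proof
      fix n assume "n \<in> {n. n \<in> {1..N} \<and> d dvd n}"
      then obtain i where "n = d * i" "1 \<le> n" "n \<le> N" by auto
      then show "n \<in> (\<lambda>i. d * i) ` {1..N div d}"
        using d by (intro image_eqI[of _ _ i]) (auto simp: less_eq_div_iff_mult_less_eq mult.commute Suc_le_eq)
    qed
    then have "card {n. n \<in> {1..N} \<and> d dvd n} \<le> N div d"
      using surj_card_le[of "{1..N div d}"] by simp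
    also have "real (N div d) \<le> real N / real d" by (rule of_nat_div_le_of_nat)
    finally have "real (card {n. n \<in> {1..N} \<and> d dvd n}) \<le> real N / real d" by simp
    then show "(\<Sum>n | n \<in> {1..N} \<and> d dvd n. 1 / real d) \<le> real N * (1 / real d ^ 2)"
      using d by (simp add: power2_eq_square divide_right_mono flip: divide_divide_eq_left)
  qed
  also have "\<dots> = real N * (\<Sum>d\<in>{B..<B + N}. 1 / real d ^ 2)"
    by (simp add: sum_distrib_left)
  also have "\<dots> \<le> real N * (1 / real (B - 1))"
    by (intro mult_left_mono order.trans[OF sum_inverse_squares_le[OF assms]]) simp_all
  finally show ?thesis by simp
qed

text \<open>Markov's inequality. The multiples of \<open>M\<close> are only some of the numbers up
  to M N, so the average over them may grow by the factor \<open>M\<close>, which the choice of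
  \<open>B\<close> absorbs.\<close>

lemma card_small_large_divisor_sum:
  assumes "B > 1" "M > 0" "\<theta> > 0" "2 * real M \<le> \<theta> * real (B - 1)"
  shows "real N / 2 \<le> real (card {m \<in> {1..N}. large_divisor_sum B (M * m) \<le> \<theta>})"
proof -
  let ?G = "{m \<in> {1..N}. large_divisor_sum B (M * m) \<le> \<theta>}"
  have nonneg: "0 \<le> large_divisor_sum B n" for n
    unfolding large_divisor_sum_def by (intro sum_nonneg) auto
  have "real (card ({1..N} - ?G)) * \<theta> = (\<Sum>m\<in>{1..N} - ?G. \<theta>)" by simp
  also have "\<dots> \<le> (\<Sum>m\<in>{1..N} - ?G. large_divisor_sum B (M * m))"
    by (intro sum_mono) auto
  also have "\<dots> \<le> (\<Sum>m\<in>{1..N}. large_divisor_sum B (M * m))"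
    using nonneg by (intro sum_mono2) auto
  also have "\<dots> = (\<Sum>n\<in>(\<lambda>m. M * m) ` {1..N}. large_divisor_sum B n)"
    using assms(2) by (subst sum.reindex) (auto simp: inj_on_def)
  also have "\<dots> \<le> (\<Sum>n\<in>{1..M * N}. large_divisor_sum B n)"
    using nonneg assms(2) by (intro sum_mono2) auto
  also have "\<dots> \<le> real (M * N) / real (B - 1)"
    by (rule sum_large_divisor_sum_le[OF assms(1)])
  also have "\<dots> \<le> \<theta> * (real N / 2)"
  proof -
    have "2 * real M * real N \<le> \<theta> * real (B - 1) * real N"
      using assms(4) by (intro mult_right_mono) auto
    then show ?thesis using assms(1) by (simp add: field_simps)
  qed
  finally have "real (card ({1..N} - ?G)) \<le> real N / 2"
    using assms(3) by (simp add: mult.commute)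
  moreover have "card {1..N} = card ?G + card ({1..N} - ?G)"
  proof -
    have "{1..N} \<inter> ?G = ?G" by blast
    then show ?thesis using card_Int_Diff[OF finite_atLeastAtMost, of 1 N ?G] by (simp only:)
  qed
  then have "real (card {1..N}) = real (card ?G) + real (card ({1..N} - ?G))"
    by (simp only: of_nat_add)
  moreover have "real (card {1..N}) = real N" by simp
  ultimately show ?thesis by linarith
qed

section \<open>Counting\<close>

context lucas_pair
begin

section \<open>From the rank to the Wieferich condition\<close>

text \<open>The rank \<open>r\<close> divides N = p - L with L = 1 or L = -1, which gives the
  congruence modulo \<open>r\<close>. The quotient t = N/r is prime to \<open>p\<close>, since
  otherwise \<open>p\<close> would divide L. As U_r divides U_n, p^2 does not divide U_r, hence not
  U_N either.\<close>

lemma not_lucas_wieferich: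
  assumes p: "Factorial_Ring.prime p" and n: "n > 0" "int p dvd U n" "\<not> int p ^ 2 dvd U n"
    and disc: "\<not> int p dvd 2 * disc"
  obtains r where "r > 0" "\<And>m. int p dvd U m \<longleftrightarrow> r dvd m"
    "[int p = 1] (mod int r) \<or> [int p = - 1] (mod int r)" "odd p" "\<not> lucas_wieferich P Q p"
proof -
  have pi: "Factorial_Ring.prime (int p)" using p prime_nat_int_transfer by blast
  obtain r where r: "r > 0" "\<And>m. int p dvd U m \<longleftrightarrow> r dvd m"
    using lucas_U_rank[OF cop pi n(1,2)] by blast
  have "p \<noteq> 2" using disc by auto
  then have odd: "odd p" using p primes_dvd_imp_eq two_is_prime_nat by blast
  have D: "\<not> int p dvd disc" using disc by auto
  have Q: "\<not> int p dvd Q"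
  proof
    assume "int p dvd Q"
    moreover obtain l where "n = Suc l" using n(1) by (cases n) auto
    ultimately have "is_unit (int p)"
      using n(2) coprime_lucas_U_Q[OF cop, of l] coprime_common_divisor by blast
    then show False using pi not_prime_unit by blast
  qed
  define L where "L = Legendre disc (int p)"
  have L: "L = 1 \<or> L = - 1"
    using D by (auto simp: L_def Legendre_def cong_0_iff)
  define N where "N = nat (int p - L)"
  have N: "int N = int p - L" "N > 0"
    using L p prime_gt_1_nat[OF p] by (auto simp: N_def)
  have "int p dvd U N"
    using lucas_apparition[OF p odd Q D] by (simp add: N_def L_def)
  then obtain t where t: "N = r * t" using r(2) by (metis dvdE)
  have "int r dvd int p - L" using t N(1) by (metis dvd_triv_left of_nat_mult)
  then have "[int p = L] (mod int r)" by (simp add: cong_iff_dvd_diff)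
  then have pm: "[int p = 1] (mod int r) \<or> [int p = - 1] (mod int r)" using L by auto
  have "\<not> int p dvd int t"
  proof
    assume "int p dvd int t"
    then have "int p dvd int p - L"
      using t N(1) by (metis dvd_mult of_nat_mult)
    then have "int p dvd L" by (simp add: dvd_diff_right_iff)
    then have "is_unit (int p)" using L by auto
    then show False using pi not_prime_unit by blast
  qed
  moreover have "\<not> int p ^ 2 dvd U r"
  proof
    assume *: "int p ^ 2 dvd U r"
    have "r dvd n" using n(2) r(2) by blast
    then have "int p ^ 2 dvd U n" by (rule dvd_trans[OF * lucas_U_dvd])
    with n(3) show False ..
  qed
  moreover have "int p dvd U r" by (simp add: r(2))
  ultimately have "\<not> int p ^ 2 dvd U N"
    unfolding t by (intro prime_square_not_dvd_lucas_U_mult[OF cop pi])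
  then have "\<not> lucas_wieferich P Q p"
    by (simp add: lucas_wieferich_def N_def L_def cong_0_iff)
  then show ?thesis using that r pm odd by blast
qed

definition pm1_non_wieferich :: "nat \<Rightarrow> nat set" where
  "pm1_non_wieferich k = {p. Factorial_Ring.prime p \<and> odd p \<and>
     ([int p = 1] (mod int k) \<or> [int p = - 1] (mod int k)) \<and> \<not> lucas_wieferich P Q p}"

text \<open>Take \<open>n = k\<^sup>j m\<close> and exclude the divisors \<open>d \<ge> B\<close> of \<open>n\<close> together with the powers \<open>q\<^sup>j\<close> for primes
  \<open>q\<close> dividing \<open>k\<close>. The rank \<open>r\<close> of the resulting prime then exceeds \<open>n/B\<close> and is still divisible by \<open>k\<close>,
  as passing from \<open>n\<close> to \<open>r\<close> removes fewer than \<open>j\<close> factors \<open>q\<close>.\<close>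

lemma pm1_non_wieferich_of_multiple:
  assumes "abc_conjecture_number_fields" "k > 1"
  obtains B M n0 \<theta> where "B > 1" "M > 0" "\<theta> > 0" "2 * real M \<le> \<theta> * real (B - 1)"
    "\<And>m. m \<ge> n0 \<Longrightarrow> m > 0 \<Longrightarrow> large_divisor_sum B (M * m) \<le> \<theta> \<Longrightarrow>
      \<exists>p \<in> pm1_non_wieferich k. int p dvd U (M * m) \<and>
        (\<exists>r > 0. (\<forall>n. int p dvd U n \<longleftrightarrow> r dvd n) \<and> M * m div r < B)"
proof -
  obtain \<delta> n0 where \<delta>: "\<delta> > 0"
    and new: "\<And>n D. n \<ge> n0 \<Longrightarrow> n > 0 \<Longrightarrow> finite D \<Longrightarrow> (\<And>d. d \<in> D \<Longrightarrow> d dvd n) \<Longrightarrow> (\<Sum>d\<in>D. 1 / real d) \<le> \<delta> \<Longrightarrow>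
      \<exists>p. Factorial_Ring.prime p \<and> int p dvd U n \<and> \<not> int p ^ 2 dvd U n \<and> \<not> int p dvd 2 * disc \<and>
        (\<forall>d\<in>D. \<not> int p dvd U (n div d))"
    using new_prime_divisor[OF assms(1)] by blast
  \<comment> \<open>Half of \<delta> for the large divisors and half for the prime powers.\<close>
  define \<theta> where "\<theta> = \<delta> / 2"
  have \<theta>: "\<theta> > 0" using \<delta> by (simp add: \<theta>_def)
  \<comment> \<open>At most \<open>k\<close> primes q divide \<open>k\<close>, each with 1/q^j \<le>
    1/2^j, so k/2^j \<le> \<theta> is wanted; passing to the successor makes \<open>j\<close>
    positive.\<close>
  obtain j0 :: nat where "real k / \<theta> < 2 ^ j0" using real_arch_pow[of 2 "real k / \<theta>"] by auto
  moreover define j where "j = Suc j0"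
  ultimately have "real k / \<theta> < 2 ^ j" by (smt (verit) power_increasing Suc_leD order_refl)
  then have j: "real k / 2 ^ j \<le> \<theta>" "j > 0"
    using \<theta> by (auto simp: field_simps j_def)
  define M where "M = k ^ j"
  have M: "M > 0" using assms(2) by (simp add: M_def)
  define B where "B = 2 + nat \<lceil>2 * real M / \<theta>\<rceil>"
  have "2 * real M / \<theta> \<le> real (B - 1)" unfolding B_def by linarith
  then have B: "B > 1" "2 * real M \<le> \<theta> * real (B - 1)"
    using \<theta> by (auto simp: B_def field_simps)
  show ?thesis
  proof (rule that[OF B(1) M \<theta> B(2)])
    fix m assume m: "m \<ge> n0" "m > 0" "large_divisor_sum B (M * m) \<le> \<theta>"
    let ?n = "M * m"
    have n: "?n \<ge> n0" "?n > 0"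
      using m M mult_le_mono[of 1 M n0 m] by auto
    define D1 where "D1 = {d. d dvd ?n \<and> B \<le> d}"
    define D2 where "D2 = (\<lambda>q. q ^ j) ` {q. Factorial_Ring.prime q \<and> q dvd k}"
    have sub: "{q. Factorial_Ring.prime q \<and> q dvd k} \<subseteq> {1..k}"
      using assms(2) prime_ge_1_nat by (auto dest: dvd_imp_le)
    have fin: "finite D1" "finite D2"
      using n finite_subset[OF sub] by (auto simp: D1_def D2_def)
    have "(\<Sum>d\<in>D2. 1 / real d) \<le> (\<Sum>q | Factorial_Ring.prime q \<and> q dvd k. 1 / real (q ^ j))"
      unfolding D2_def using finite_subset[OF sub] by (intro order.trans[OF sum_image_le]) auto
    also have "\<dots> \<le> (\<Sum>q | Factorial_Ring.prime q \<and> q dvd k. 1 / 2 ^ j)"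
    proof (intro sum_mono)
      fix q assume "q \<in> {q. Factorial_Ring.prime q \<and> q dvd k}"
      then have "(2::real) ^ j \<le> real q ^ j"
        using prime_ge_2_nat[of q] by (intro power_mono) auto
      then show "1 / real (q ^ j) \<le> 1 / 2 ^ j" by (simp add: frac_le)
    qed
    also have "\<dots> \<le> real k / 2 ^ j"
      using card_mono[OF _ sub] by (simp add: divide_right_mono)
    finally have "(\<Sum>d\<in>D2. 1 / real d) \<le> \<theta>" using j by linarith
    moreover have "(\<Sum>d\<in>D1. 1 / real d) \<le> \<theta>"
      using m(3) by (simp add: large_divisor_sum_def D1_def)
    moreover have "(\<Sum>d\<in>D1 \<union> D2. 1 / real d) \<le> (\<Sum>d\<in>D1. 1 / real d) + (\<Sum>d\<in>D2. 1 / real d)"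
      using fin sum.union_inter[OF fin, of "\<lambda>d. 1 / real d"] sum_nonneg[of "D1 \<inter> D2" "\<lambda>d. 1 / real d"] by simp
    ultimately have "(\<Sum>d\<in>D1 \<union> D2. 1 / real d) \<le> \<delta>" by (simp add: \<theta>_def)
    moreover have D2n: "d dvd ?n" if "d \<in> D2" for d
      using that by (auto simp: D2_def M_def intro!: dvd_mult2 dvd_power_same)
    moreover have "d dvd ?n" if "d \<in> D1" for d
      using that by (simp add: D1_def)
    ultimately obtain p where p: "Factorial_Ring.prime p" "int p dvd U ?n" "\<not> int p ^ 2 dvd U ?n"
        "\<not> int p dvd 2 * disc" and not: "\<And>d. d \<in> D1 \<union> D2 \<Longrightarrow> \<not> int p dvd U (?n div d)"
      using new[OF n, of "D1 \<union> D2"] fin by blast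
    obtain r where r: "r > 0" "\<And>n. int p dvd U n \<longleftrightarrow> r dvd n"
      "[int p = 1] (mod int r) \<or> [int p = - 1] (mod int r)" "odd p" "\<not> lucas_wieferich P Q p"
      using not_lucas_wieferich[OF p(1) n(2) p(2-4)] by blast
    have rn: "r dvd ?n" using p(2) r(2) by blast
    define d where "d = ?n div r"
    have dr: "?n = d * r" using rn by (simp add: d_def)
    then have "d \<noteq> 0" using n(2) by (metis mult_zero_left less_irrefl)
    then have d: "?n = d * r" "d dvd ?n" "?n div d = r"
      using dr by (metis, metis dvd_triv_left, metis nonzero_mult_div_cancel_left)
    \<comment> \<open>Otherwise \<open>p\<close> could not divide U_{n/d} = U_r.\<close>
    have "d \<notin> D1" using not[of d] r(2) d(3) by auto
    then have "d < B" using d(2) by (auto simp: D1_def)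
    \<comment> \<open>If q^j divided \<open>d\<close>, then \<open>r\<close> would divide n/q^j, and
      \<open>p\<close> would divide a term from which it is excluded.\<close>
    have "k dvd k ^ j * m div d"
    proof (rule dvd_div_of_prime_powers_not_dvd)
      fix q assume "Factorial_Ring.prime q" "q dvd k"
      then have q: "q ^ j \<in> D2" by (auto simp: D2_def)
      show "\<not> q ^ j dvd d"
      proof
        assume "q ^ j dvd d"
        then obtain e where "d = q ^ j * e" by (elim dvdE)
        then have "?n = q ^ j * (e * r)" using d(1) by simp
        then have "?n div q ^ j = e * r" using n(2) by auto
        then have "r dvd ?n div q ^ j" by simp
        then show False using r(2)[of "?n div q ^ j"] not[of "q ^ j"] q by simp
      qed
    qed (use j assms m d in \<open>auto simp: M_def\<close>)
    then have "k dvd r" using d(3) by (simp add: M_def)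
    then have "int k dvd int r" by simp
    then have "[int p = 1] (mod int k) \<or> [int p = - 1] (mod int k)"
      using r(3) cong_dvd_modulus by blast
    then have "p \<in> pm1_non_wieferich k"
      using p r by (simp add: pm1_non_wieferich_def)
    then show "\<exists>p \<in> pm1_non_wieferich k. int p dvd U ?n \<and>
        (\<exists>r > 0. (\<forall>n. int p dvd U n \<longleftrightarrow> r dvd n) \<and> ?n div r < B)"
      using p(2) r(1,2) \<open>d < B\<close> unfolding d_def by blast
  qed
qed

section \<open>Number of primes obtained\<close>

text \<open>At least half of the m \<le> N have a small divisor sum, at most \<open>n0\<close> of
  these are dropped as too small, and each prime serves at most \<open>B\<close> of the
  others.\<close>

lemma pm1_non_wieferich_count:
  assumes "abc_conjecture_number_fields" "k > 1"
  obtains B M n0 :: nat where "B > 0" "M > 0"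
    "\<And>N. real N / 2 \<le> real n0 + real B *
       real (card {p \<in> pm1_non_wieferich k. real p \<le> (of_int (\<bar>P\<bar> + \<bar>Q\<bar>)) ^ (M * N)})"
proof -
  obtain B M n0 \<theta> where B: "B > 1" "M > 0" "\<theta> > 0" "2 * real M \<le> \<theta> * real (B - 1)"
    and ex: "\<And>m. m \<ge> n0 \<Longrightarrow> m > 0 \<Longrightarrow> large_divisor_sum B (M * m) \<le> \<theta> \<Longrightarrow>
      \<exists>p \<in> pm1_non_wieferich k. int p dvd U (M * m) \<and>
        (\<exists>r > 0. (\<forall>n. int p dvd U n \<longleftrightarrow> r dvd n) \<and> M * m div r < B)"
    by (rule pm1_non_wieferich_of_multiple[OF assms]) (rule that)
  show ?thesis
  proof (rule that[of B M n0])
    fix N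
    let ?E = "of_int (\<bar>P\<bar> + \<bar>Q\<bar>) :: real"
    let ?S = "{p \<in> pm1_non_wieferich k. real p \<le> ?E ^ (M * N)}"
    define G where "G = {m \<in> {1..N}. large_divisor_sum B (M * m) \<le> \<theta>}"
    define G' where "G' = G - {..<n0}"
    have fin: "finite G" "finite G'" by (auto simp: G_def G'_def)
    have "\<forall>m\<in>G'. \<exists>p \<in> pm1_non_wieferich k. int p dvd U (M * m) \<and>
        (\<exists>r > 0. (\<forall>n. int p dvd U n \<longleftrightarrow> r dvd n) \<and> M * m div r < B)"
      using ex by (auto simp: G_def G'_def)
    then obtain f where f: "\<And>m. m \<in> G' \<Longrightarrow> f m \<in> pm1_non_wieferich k \<and> int (f m) dvd U (M * m) \<and>
        (\<exists>r > 0. (\<forall>n. int (f m) dvd U n \<longleftrightarrow> r dvd n) \<and> M * m div r < B)"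
      by metis
    have E: "1 \<le> \<bar>P\<bar> + \<bar>Q\<bar>" using P by linarith
    have fS: "f ` G' \<subseteq> ?S"
    proof (rule image_subsetI)
      fix m assume m: "m \<in> G'"
      then have "1 \<le> m" "m \<le> N" by (auto simp: G_def G'_def)
      then have "U (M * m) \<noteq> 0" using B(2) by (intro U_nonzero) auto
      then have "int (f m) \<le> \<bar>U (M * m)\<bar>"
        using f[OF m] dvd_imp_le_int[of "U (M * m)" "int (f m)"] by simp
      moreover have "\<bar>U (M * m)\<bar> \<le> (\<bar>P\<bar> + \<bar>Q\<bar>) ^ (M * m)" by (rule abs_U_le_power)
      moreover have "(\<bar>P\<bar> + \<bar>Q\<bar>) ^ (M * m) \<le> (\<bar>P\<bar> + \<bar>Q\<bar>) ^ (M * N)"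
        using E \<open>m \<le> N\<close> by (intro power_increasing) auto
      ultimately have "int (f m) \<le> (\<bar>P\<bar> + \<bar>Q\<bar>) ^ (M * N)" by linarith
      then have "real_of_int (int (f m)) \<le> real_of_int ((\<bar>P\<bar> + \<bar>Q\<bar>) ^ (M * N))"
        by (rule of_int_le_iff[THEN iffD2])
      then show "f m \<in> ?S" using f[OF m] by simp
    qed
    have finS: "finite ?S"
    proof (rule finite_subset)
      show "?S \<subseteq> {..nat \<lfloor>?E ^ (M * N)\<rfloor>}" by (auto simp: le_nat_floor)
    qed simp
    \<comment> \<open>\<open>m\<close> is recovered from the rank \<open>r\<close> of its prime and the number \<open>M m / r < B\<close>.\<close>
    have fiber: "card {m \<in> G'. f m = p} \<le> B" if p: "p \<in> f ` G'" for p
    proof -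
      obtain m where "m \<in> G'" "f m = p" using p by blast
      with f[of m] obtain r where r: "r > 0" "\<forall>n. int p dvd U n \<longleftrightarrow> r dvd n"
        by blast
      have B': "M * m = r * (M * m div r) \<and> M * m div r < B" if "m \<in> G'" "f m = p" for m
      proof -
        from f[OF that(1)] that(2) obtain r' where r': "r' > 0" "\<forall>n. int p dvd U n \<longleftrightarrow> r' dvd n" "M * m div r' < B"
          by blast
        have "r' = r" using r(2) r'(2) by (intro dvd_antisym) auto
        moreover have "r dvd M * m" using f[OF that(1)] that(2) r(2) by auto
        ultimately show ?thesis using r'(3) by simp
      qed
      have "inj_on (\<lambda>m. M * m div r) {m \<in> G'. f m = p}"
      proof (rule inj_onI)
        fix a b assume "a \<in> {m \<in> G'. f m = p}" "b \<in> {m \<in> G'. f m = p}" "M * a div r = M * b div r"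
        then have "M * a = M * b" using B'[of a] B'[of b] by auto
        then show "a = b" using B(2) by simp
      qed
      moreover have "(\<lambda>m. M * m div r) ` {m \<in> G'. f m = p} \<subseteq> {..<B}"
        using B' by blast
      ultimately have "card {m \<in> G'. f m = p} \<le> card {..<B}"
        by (intro card_inj_on_le) auto
      then show ?thesis by simp
    qed
    have "G' = (\<Union>p\<in>f ` G'. {m \<in> G'. f m = p})" by auto
    then have "card G' \<le> (\<Sum>p\<in>f ` G'. card {m \<in> G'. f m = p})"
      using card_UN_le[of "f ` G'" "\<lambda>p. {m \<in> G'. f m = p}"] fin(2) by simp
    also have "\<dots> \<le> card (f ` G') * B"
      using sum_bounded_above[of "f ` G'" "\<lambda>p. card {m \<in> G'. f m = p}" B] fiber by simp
    also have "\<dots> \<le> card ?S * B"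
      using card_mono[OF finS fS] by simp
    finally have "card G' \<le> card ?S * B" .
    moreover have "card G \<le> card G' + n0"
      using diff_card_le_card_Diff[of "{..<n0}" G] by (simp add: G'_def)
    ultimately have "card G \<le> n0 + B * card ?S" by (simp add: mult.commute)
    then have "real (card G) \<le> real (n0 + B * card ?S)" by (rule of_nat_mono)
    then show "real N / 2 \<le> real n0 + real B * real (card ?S)"
      using card_small_large_divisor_sum[OF B, of N] by (simp add: G_def)
  qed (use B in auto)
qed

end

section \<open>The logarithmic lower bound\<close>

theorem mainTheorem1:
  fixes P Q k :: int
  assumes "P \<noteq> 0" and "Q \<noteq> 0" and "coprime P Q" and "lucas_disc P Q > 0"
    and "k \<ge> 2"
    and "abc_conjecture_number_fields"
  shows "\<exists>C>0. \<forall>\<^sub>F x :: real in at_top.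
    ln x < C * real (card {p :: nat. Factorial_Ring.prime p \<and> odd p \<and> real p \<le> x \<and>
      ([int p = 1] (mod k) \<or> [int p = - 1] (mod k)) \<and> \<not> lucas_wieferich P Q p})"
proof -
  interpret lucas_pair P Q using assms by unfold_locales
  define S where "S = (\<lambda>x. {p \<in> pm1_non_wieferich (nat k). real p \<le> x})"
  have S: "{p :: nat. Factorial_Ring.prime p \<and> odd p \<and> real p \<le> x \<and>
      ([int p = 1] (mod k) \<or> [int p = - 1] (mod k)) \<and> \<not> lucas_wieferich P Q p} = S x" for x
    using assms(5) by (auto simp: S_def pm1_non_wieferich_def)
  define E where "E = real_of_int (\<bar>P\<bar> + \<bar>Q\<bar>)"
  have "\<bar>P\<bar> + \<bar>Q\<bar> \<ge> 2" using assms by linarith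
  then have E: "E > 1" unfolding E_def by linarith
  have "nat k > 1" using assms(5) by simp
  then obtain B M n0 where B: "B > 0" "M > 0"
    and count: "\<And>N. real N / 2 \<le> real n0 + real B * real (card (S (E ^ (M * N))))"
    using pm1_non_wieferich_count[OF assms(6)] unfolding S_def E_def by blast
  define L where "L = real M * ln E"
  have L: "L > 0" using B E by (simp add: L_def)
  show ?thesis
    unfolding S
  proof (intro exI[of _ "4 * L * real B"] conjI)
    show "4 * L * real B > 0" using L B by simp
    \<comment> \<open>The count gives ln x < L (2 n0 + 1) + 2 L B card (S x). The threshold keeps
      the first summand below half of ln x, whence the constant 4 L B.\<close>
    have "eventually (\<lambda>x. ln x > 2 * L * (2 * real n0 + 1)) at_top"
      using ln_at_top by (rule filterlim_at_top_dense[THEN iffD1, rule_format])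
    moreover have "eventually (\<lambda>x::real. x \<ge> 1) at_top" by (rule eventually_ge_at_top)
    ultimately show "\<forall>\<^sub>F x in at_top. ln x < 4 * L * real B * real (card (S x))"
    proof eventually_elim
      case (elim x)
      \<comment> \<open>The largest N with E^(M N) \<le> x.\<close>
      define N where "N = nat \<lfloor>ln x / L\<rfloor>"
      have "0 \<le> ln x / L" using elim L by simp
      then have N: "real N \<le> ln x / L" "ln x / L < real N + 1"
        unfolding N_def by linarith+
      have "real N * L \<le> ln x" using N(1) L by (simp add: field_simps)
      then have "ln (E ^ (M * N)) \<le> ln x"
        using E by (simp add: ln_realpow L_def mult_ac)
      then have "E ^ (M * N) \<le> x"
        using E elim by simp
      moreover have "finite (S x)"
        unfolding S_def by (rule finite_subset[of _ "{..nat \<lfloor>x\<rfloor>}"]) (auto simp: le_nat_floor)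
      ultimately have "card (S (E ^ (M * N))) \<le> card (S x)"
        by (intro card_mono) (auto simp: S_def)
      then have "real B * real (card (S (E ^ (M * N)))) \<le> real B * real (card (S x))"
        by (intro mult_left_mono) auto
      then have "real N + 1 \<le> 2 * real n0 + 1 + 2 * (real B * real (card (S x)))"
        using count[of N] by linarith
      then have "ln x / L < 2 * real n0 + 1 + 2 * (real B * real (card (S x)))"
        using N(2) by linarith
      then have "ln x < L * (2 * real n0 + 1) + 2 * (L * real B * real (card (S x)))"
        using L by (simp add: field_simps)
      then show ?case using elim by simp
    qed
  qed
qed

end
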